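(* Let $G$ be a tree of order $n$ and maximum degree $\Delta \ge 3$. If $G$ is isomorphic to a tree in $\mathcal{T}_\Delta$, then \[\gamma^{\rm ID}(G) = \left(\frac{\Delta-1}{\Delta}\right) n + \frac{1}{\Delta}.\] If $G$ is not isomorphic to any tree in $\mathcal{T}_\Delta$, then \[\gamma^{\rm ID}(G) \le \left(\frac{\Delta-1}{\Delta}\right) n.\]
   Context: For a graph $G$ and vertex $v$, $N[v]$ is the closed neighborhood. An identifying code of $G$ is a set $C\subseteq V(G)$ such that every vertex $v$ has $N[v]\cap C\neq\emptyset$ and for all distinct $u,v$, $N[u]\cap C \ne N[v]\cap C$. $\gamma^{\rm ID}(G)$ is the minimum size of an identifying code (every tree of maximum degree at least 3 admits one). A $k$-star is $K_{1,k}$. For a graph $G'$, a vertex $v$ of $G'$ and a star $S$, $G'\rhd_v S$ is the graph obtained from the disjoint union of $G'$ and $S$ by identifying $v$ with a leaf of $S$ ("appending $S$ onto $v$"). An appended 3-star is a graph obtained by starting from a 3-star $G_0=S_0$ and, for $i=1,\dots,p$ ($p\ge 0$), setting $G_i=G_{i-1}\rhd_{v_{i-1}} S_i$ where $S_i$ is a 3-star and $v_{i-1}$ is a vertex of $G_{i-1}$. Let $T_2$ be the tree with vertices $w,x,y,z,u_1,a_1,b_1$ and edges $wx,xy,yz,zu_1,u_1a_1,u_1b_1$, and let $T_3$ be the tree obtained from $T_2$ by adding vertices $u_2,a_2,b_2$ and edges $zu_2,u_2a_2,u_2b_2$. For $\Delta=3$, $\mathcal{T}_3$ consists of $T_2$,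 $T_3$, and all appended 3-stars of maximum degree 3 (at most 3 for the star $K_{1,3}$ itself) and diameter at most 6 (these are 12 trees in total, including $K_{1,3}$). For $\Delta\ge 4$, $\mathcal{T}_\Delta=\{K_{1,\Delta}\}$. *)

theory Defs
  imports Complex_Main
begin

definition graph :: "'a set \<Rightarrow> ('a \<Rightarrow> 'a \<Rightarrow> bool) \<Rightarrow> bool" where
  "graph V E \<longleftrightarrow> finite V \<and> (\<forall>u v. E u v \<longrightarrow> u \<in> V \<and> v \<in> V)
     \<and> (\<forall>u v. E u v \<longrightarrow> E v u) \<and> (\<forall>v. \<not> E v v)"

definition walk :: "'a set \<Rightarrow> ('a \<Rightarrow> 'a \<Rightarrow> bool) \<Rightarrow> 'a list \<Rightarrow> bool" where
  "walk V E p \<longleftrightarrow> p \<noteq> [] \<and> set p \<subseteq> V \<and> (\<forall>i. Suc i < length p \<longrightarrow> E (p ! i) (p ! Suc i))"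

definition connected_graph :: "'a set \<Rightarrow> ('a \<Rightarrow> 'a \<Rightarrow> bool) \<Rightarrow> bool" where
  "connected_graph V E \<longleftrightarrow>
     (\<forall>u\<in>V. \<forall>v\<in>V. \<exists>p. walk V E p \<and> hd p = u \<and> last p = v)"

definition has_cycle :: "'a set \<Rightarrow> ('a \<Rightarrow> 'a \<Rightarrow> bool) \<Rightarrow> bool" where
  "has_cycle V E \<longleftrightarrow> (\<exists>p. walk V E p \<and> distinct p \<and> length p \<ge> 3 \<and> E (last p) (hd p))"

definition tree :: "'a set \<Rightarrow> ('a \<Rightarrow> 'a \<Rightarrow> bool) \<Rightarrow> bool" where
  "tree V E \<longleftrightarrow> graph V E \<and> V \<noteq> {} \<and> connected_graph V E \<and> \<not> has_cycle V E"

definition degree :: "'a set \<Rightarrow> ('a \<Rightarrow> 'a \<Rightarrow> bool) \<Rightarrow> 'a \<Rightarrow> nat" where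
  "degree V E v = card {u \<in> V. E v u}"

definition max_degree :: "'a set \<Rightarrow> ('a \<Rightarrow> 'a \<Rightarrow> bool) \<Rightarrow> nat" where
  "max_degree V E = Max (degree V E ` V)"

definition diam_le :: "'a set \<Rightarrow> ('a \<Rightarrow> 'a \<Rightarrow> bool) \<Rightarrow> nat \<Rightarrow> bool" where
  "diam_le V E k \<longleftrightarrow>
     (\<forall>u\<in>V. \<forall>v\<in>V. \<exists>p. walk V E p \<and> hd p = u \<and> last p = v \<and> length p \<le> Suc k)"

definition closed_nbhd :: "'a set \<Rightarrow> ('a \<Rightarrow> 'a \<Rightarrow> bool) \<Rightarrow> 'a \<Rightarrow> 'a set" where
  "closed_nbhd V E v = insert v {u \<in> V. E v u}"

definition identifying_code :: "'a set \<Rightarrow> ('a \<Rightarrow> 'a \<Rightarrow> bool) \<Rightarrow> 'a set \<Rightarrow> bool" where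
  "identifying_code V E C \<longleftrightarrow> C \<subseteq> V
     \<and> (\<forall>v\<in>V. closed_nbhd V E v \<inter> C \<noteq> {})
     \<and> (\<forall>u\<in>V. \<forall>v\<in>V. u \<noteq> v \<longrightarrow> closed_nbhd V E u \<inter> C \<noteq> closed_nbhd V E v \<inter> C)"

definition gamma_ID :: "'a set \<Rightarrow> ('a \<Rightarrow> 'a \<Rightarrow> bool) \<Rightarrow> nat" where
  "gamma_ID V E = Min {card C | C. identifying_code V E C}"

definition graph_iso ::
  "'a set \<Rightarrow> ('a \<Rightarrow> 'a \<Rightarrow> bool) \<Rightarrow> 'b set \<Rightarrow> ('b \<Rightarrow> 'b \<Rightarrow> bool) \<Rightarrow> bool" where
  "graph_iso V E W F \<longleftrightarrow>
     (\<exists>f. bij_betw f V W \<and> (\<forall>u\<in>V. \<forall>v\<in>V. E u v \<longleftrightarrow> F (f u) (f v)))"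

definition adj_of :: "('a \<times> 'a) set \<Rightarrow> 'a \<Rightarrow> 'a \<Rightarrow> bool" where
  "adj_of S x y \<longleftrightarrow> (x, y) \<in> S \<or> (y, x) \<in> S"

definition star_V :: "nat \<Rightarrow> nat set" where "star_V k = {0..k}"
definition star_E :: "nat \<Rightarrow> nat \<Rightarrow> nat \<Rightarrow> bool" where
  "star_E k = adj_of {(0, i) | i. 1 \<le> i \<and> i \<le> k}"

text \<open>Appended 3-stars (on natural-number vertices). Appending a 3-star onto v:
v becomes a leaf of a new star with new centre c and new leaves a, b.\<close>

inductive appended3 :: "nat set \<Rightarrow> (nat \<Rightarrow> nat \<Rightarrow> bool) \<Rightarrow> bool" where
  base: "distinct [c, a, b, d] \<Longrightarrow>
     appended3 {c, a, b, d} (adj_of {(c, a), (c, b), (c, d)})"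
| step: "appended3 V E \<Longrightarrow> v \<in> V \<Longrightarrow> distinct [c, a, b] \<Longrightarrow>
     c \<notin> V \<Longrightarrow> a \<notin> V \<Longrightarrow> b \<notin> V \<Longrightarrow>
     appended3 (V \<union> {c, a, b}) (\<lambda>x y. E x y \<or> adj_of {(v, c), (c, a), (c, b)} x y)"

text \<open>T_2: w=0, x=1, y=2, z=3, u1=4, a1=5, b1=6. T_3 adds u2=7, a2=8, b2=9.\<close>

definition T2_V :: "nat set" where "T2_V = {0..6}"
definition T2_E :: "nat \<Rightarrow> nat \<Rightarrow> bool" where
  "T2_E = adj_of {(0,1), (1,2), (2,3), (3,4), (4,5), (4,6)}"
definition T3_V :: "nat set" where "T3_V = {0..9}"
definition T3_E :: "nat \<Rightarrow> nat \<Rightarrow> bool" where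
  "T3_E = adj_of {(0,1), (1,2), (2,3), (3,4), (4,5), (4,6), (3,7), (7,8), (7,9)}"

definition in_T_family :: "nat \<Rightarrow> nat set \<Rightarrow> (nat \<Rightarrow> nat \<Rightarrow> bool) \<Rightarrow> bool" where
  "in_T_family \<Delta> V E \<longleftrightarrow>
     (if \<Delta> = 3 then
        (V = T2_V \<and> E = T2_E) \<or> (V = T3_V \<and> E = T3_E)
        \<or> (appended3 V E \<and> max_degree V E = 3 \<and> diam_le V E 6)
      else V = star_V \<Delta> \<and> E = star_E \<Delta>)"

end

theory Submission
  imports Defs
begin

text \<open>
  Induction on the order, for induced subgraphs of one fixed graph. A tree contains a pendant star
  (a vertex with at least two leaf neighbours and one further neighbour) or, at the end of a longest
  path, one of three small configurations hanging at a vertex. Removing \<open>m \<le> \<Delta>\<close>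
  vertices of such a configuration leaves a tree whose codes extend by \<open>m - 1\<close> vertices,
  which preserves the bound \<open>(\<Delta> - 1) n / \<Delta>\<close>. Only \<open>m = \<Delta>\<close> leaves no
  slack, and then only an exceptional smaller tree causes trouble. Such a tree either stays exceptional
  or has a set with one vertex fewer than its optimal codes that fails only in separating the
  attachment vertex from other vertices, which the attached configuration repairs.

  For \<open>\<Delta> = 3\<close> the exceptional trees are the single vertex, the path \<open>w x y z\<close> with 3-stars
  hung at \<open>z\<close> (at most two by the degree bound: \<open>P\<^sub>4\<close>, \<open>T\<^sub>2\<close>, \<open>T\<^sub>3\<close>), and
  \<open>K\<^sub>1\<^sub>,\<^sub>3\<close> with 3-stars hung at its leaves. The latter are exactly the appended 3-stars of
  diameter at most 6: a star appended elsewhere either turns another star centre into the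
  centre of the tree or creates a path with nine vertices.
\<close>

section \<open>Extending codes along pendant configurations\<close>

text \<open>Deleting a configuration may lower the maximum degree, so the induction keeps \<Delta>
  only as an upper bound on the degrees. This is why the single vertex and the four-vertex path
  count as exceptional: they attain the larger value although their maximum degree keeps them out of
  the family. The two-vertex tree, which has no identifying code, is carried along as a separate
  outcome. Whether the attachment vertex of a faulty code is itself a code vertex matters for a hung
  3-star but not for the other configurations with three vertices, so two strengths of faulty code
  occur. Stars are removed with priority; in a tree without them an exceptional remainder can be
  attached in very few ways. For the exact value, \<open>((\<Delta> - 1) * n + 1) / \<Delta>\<close>
  code vertices mean \<open>(n - 1) / \<Delta>\<close> omitted ones. The lower bound is therefore a
  charging argument: for \<open>\<Delta> = 3\<close> each hung star pays for one omitted vertex with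
  its three new vertices, and the core of four vertices pays for one more and keeps a remainder of
  1.\<close>

locale sgraph =
  fixes E :: "'a \<Rightarrow> 'a \<Rightarrow> bool"
  assumes E_sym: "E u v \<Longrightarrow> E v u" and E_irrefl: "\<not> E v v"
begin

text \<open>Unlike \<open>closed_nbhd\<close> this mentions no vertex set, so whether a code
  separates two vertices is the same in every induced subgraph containing them and the code.\<close>

definition adjeq :: "'a \<Rightarrow> 'a \<Rightarrow> bool" where
  "adjeq u d \<longleftrightarrow> u = d \<or> E u d"

definition separates :: "'a set \<Rightarrow> 'a \<Rightarrow> 'a \<Rightarrow> bool" where
  "separates C u v \<longleftrightarrow> (\<exists>d\<in>C. adjeq u d \<noteq> adjeq v d)"

text \<open>Pairs meeting \<open>U\<close> need not be separated: attaching a configuration at a vertex of \<open>U\<close>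
  adds a code vertex whose only old neighbour is that vertex.\<close>

definition almost_code :: "'a set \<Rightarrow> 'a set \<Rightarrow> 'a set \<Rightarrow> bool" where
  "almost_code V U C \<longleftrightarrow> C \<subseteq> V \<and> (\<forall>u\<in>V. \<exists>d\<in>C. adjeq u d) \<and>
     (\<forall>u\<in>V - U. \<forall>v\<in>V - U. u \<noteq> v \<longrightarrow> separates C u v)"

lemma separates_sym: "separates C u v \<Longrightarrow> separates C v u"
  by (auto simp: separates_def)

lemma separates_mono: "separates C u v \<Longrightarrow> C \<subseteq> D \<Longrightarrow> separates D u v"
  by (auto simp: separates_def)

lemma separatesI: "d \<in> C \<Longrightarrow> adjeq u d \<Longrightarrow> \<not> adjeq v d \<Longrightarrow> separates C u v"
  by (auto simp: separates_def)

lemma separatesI': "d \<in> C \<Longrightarrow> \<not> adjeq u d \<Longrightarrow> adjeq v d \<Longrightarrow> separates C u v"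
  by (auto simp: separates_def)

lemma identifying_code_iff: "identifying_code V E C \<longleftrightarrow> almost_code V {} C"
proof -
  have 1: "closed_nbhd V E v \<inter> C = {d\<in>C. adjeq v d}" if "C \<subseteq> V" "v \<in> V" for v
    using that by (auto simp: closed_nbhd_def adjeq_def)
  have 2: "{d\<in>C. adjeq u d} \<noteq> {d\<in>C. adjeq v d} \<longleftrightarrow> separates C u v" for u v
    unfolding separates_def by blast
  have 3: "{d\<in>C. adjeq u d} \<noteq> {} \<longleftrightarrow> (\<exists>d\<in>C. adjeq u d)" for u
    by blast
  show ?thesis
  proof (cases "C \<subseteq> V")
    case True
    then show ?thesis
      unfolding identifying_code_def almost_code_def
      by (simp only: 1 2 3 True cong: ball_cong) simp
  qed (simp add: identifying_code_def almost_code_def)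
qed

lemma almost_code_mono: "almost_code V U C \<Longrightarrow> U \<subseteq> U' \<Longrightarrow> almost_code V U' C"
  unfolding almost_code_def by blast

text \<open>Old pairs stay separated because separation only improves as the code grows. The
  attachment vertex \<open>v\<close> is the one old vertex that can profit from the new code
  vertices, so only \<open>v\<close> is struck from \<open>U\<close>; if it was not in
  \<open>U\<close>, nothing has to be shown about it.\<close>

lemma almost_code_extend:
  assumes "almost_code V U C" "C \<subseteq> C'" "C' \<subseteq> V \<union> X" "v \<in> V"
    and dom: "\<And>t. t \<in> X \<Longrightarrow> \<exists>d\<in>C'. adjeq t d"
    and new_old: "\<And>t u. t \<in> X \<Longrightarrow> u \<in> V \<Longrightarrow> separates C' t u"
    and new_new: "\<And>t t'. t \<in> X \<Longrightarrow> t' \<in> X \<Longrightarrow> t \<noteq> t' \<Longrightarrow> separates C' t t'"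
    and v: "\<And>u. v \<in> U \<Longrightarrow> u \<in> V \<Longrightarrow> u \<noteq> v \<Longrightarrow> separates C' v u"
  shows "almost_code (V \<union> X) (U - {v}) C'"
proof -
  have old: "separates C' s t" if "s \<in> V" "t \<in> V" "s \<noteq> t" "s \<notin> U - {v}" "t \<notin> U - {v}" for s t
  proof (cases "s \<in> U \<or> t \<in> U")
    case True
    then show ?thesis using v separates_sym that by blast
  next
    case False
    then have "separates C s t" using assms(1) that unfolding almost_code_def by blast
    then show ?thesis using separates_mono assms(2) by blast
  qed
  show ?thesis unfolding almost_code_def
  proof (intro conjI ballI impI)
    show "C' \<subseteq> V \<union> X" by fact
    show "\<exists>d\<in>C'. adjeq u d" if "u \<in> V \<union> X" for u
      using that dom assms(1,2) unfolding almost_code_def by blast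
    show "separates C' s t" if "s \<in> V \<union> X - (U - {v})" "t \<in> V \<union> X - (U - {v})" "s \<noteq> t" for s t
      using that old new_old new_new separates_sym by (metis Diff_iff UnE)
  qed
qed

text \<open>Exactly one vertex of the new star is left out of the code. Coding \<open>x\<close>
  repairs \<open>v\<close>, the only old neighbour of \<open>x\<close>, but then \<open>x\<close>
  must be told apart from each coded leaf: by \<open>v\<close> itself or by a second coded leaf,
  available from three leaves on. With two leaves and \<open>v\<close> uncoded, \<open>x\<close> is
  the vertex left out; \<open>v\<close> is then not repaired and must lie outside
  \<open>U\<close>.\<close>

lemma star_extend:
  assumes al: "almost_code V U C" and fin: "finite V" and vV: "v \<in> V"
    and A: "finite A" "2 \<le> card A" "x \<notin> V" "x \<notin> A" "A \<inter> V = {}"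
    and xv: "\<And>u. u \<in> V \<Longrightarrow> E x u \<longleftrightarrow> u = v"
    and xa: "\<And>a. a \<in> A \<Longrightarrow> E x a"
    and aa: "\<And>a u. a \<in> A \<Longrightarrow> u \<in> V \<union> A \<Longrightarrow> \<not> E a u"
    and c: "v \<in> C \<or> 3 \<le> card A \<or> v \<notin> U"
  obtains C' where "almost_code (V \<union> insert x A) (U - {v}) C'" "C \<subseteq> C'" "card C' = card C + card A"
proof -
  have CV: "C \<subseteq> V" using al by (simp add: almost_code_def)
  then have finC: "finite C" using fin finite_subset by blast
  have dom: "\<exists>d\<in>C. adjeq u d" if "u \<in> V" for u using al that by (auto simp: almost_code_def)
  have two: "\<exists>b\<in>A. b \<noteq> a" for a
  proof (rule ccontr)
    assume "\<not> ?thesis"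
    then have "A \<subseteq> {a}" by blast
    then have "card A \<le> card {a}" by (intro card_mono) auto
    then show False using A(2) by simp
  qed
  have ax: "E a x" if "a \<in> A" for a using xa E_sym that by blast
  have ua: "\<not> E u a" if "a \<in> A" "u \<in> V \<union> A" for a u using aa E_sym that by blast
  have ux: "E u x \<longleftrightarrow> u = v" if "u \<in> V" for u using xv E_sym that by blast
  have disj: "x \<noteq> u" "u \<noteq> x" "a \<noteq> u" "u \<noteq> a" if "u \<in> V" "a \<in> A" for u a using that A by auto
  have xA: "x \<noteq> a" "a \<noteq> x" if "a \<in> A" for a using that A by auto
  note sm = adjeq_def ax xa aa ua ux xv disj xA
  show ?thesis
  proof (cases "v \<in> C \<or> 3 \<le> card A")
    case True
    obtain a where a: "a \<in> A" using two by blast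
    let ?C = "C \<union> insert x (A - {a})"
    have "almost_code (V \<union> insert x A) (U - {v}) ?C"
    proof (rule almost_code_extend[OF al])
      show "\<exists>d\<in>?C. adjeq t d" if "t \<in> insert x A" for t
        using that by (intro bexI[of _ x]) (auto simp: sm)
      have vx: "separates ?C t v" if t: "t \<in> insert x A" for t
      proof -
        consider "t = x" | "t \<in> A" using t by blast
        then show ?thesis
        proof cases
          case 1
          obtain b where "b \<in> A" "b \<noteq> a" using two by blast
          then show ?thesis using 1 vV by (intro separatesI[of b]) (auto simp: sm)
        next
          case 2
          obtain d where "d \<in> C" "adjeq v d" using dom vV by blast
          then show ?thesis using 2 vV CV A(5) by (intro separatesI'[of d]) (auto simp: sm)
        qed
      qed
      show "separates ?C t u" if "t \<in> insert x A" "u \<in> V" for t u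
      proof (cases "u = v")
        case True
        then show ?thesis using vx that by simp
      next
        case False
        then show ?thesis using that A(3) by (intro separatesI[of x]) (auto simp: sm)
      qed
      have key: "separates ?C x t" if t: "t \<in> A" for t
      proof (cases "v \<in> C")
        case True
        then show ?thesis using t vV by (intro separatesI[of v]) (auto simp: sm)
      next
        case False
        then have "3 \<le> card A" using \<open>v \<in> C \<or> 3 \<le> card A\<close> by simp
        have "\<not> A \<subseteq> {a, t}"
        proof
          assume "A \<subseteq> {a, t}"
          then have "card A \<le> card {a, t}" by (intro card_mono) auto
          also have "\<dots> \<le> 2" by (simp add: card_insert_if)
          finally show False using \<open>3 \<le> card A\<close> by simp
        qed
        then obtain b where "b \<in> A" "b \<noteq> a" "b \<noteq> t" by blast
        then show ?thesis using t by (intro separatesI[of b]) (auto simp: sm)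
      qed
      have key2: "separates ?C s t" if "s \<in> A" "t \<in> A" "s \<noteq> t" "t \<noteq> a" for s t
        using that by (intro separatesI'[of t]) (auto simp: sm)
      show "separates ?C s t" if "s \<in> insert x A" "t \<in> insert x A" "s \<noteq> t" for s t
        using that key key2 separates_sym by (metis insertE)
      show "separates ?C v u" if "u \<in> V" "u \<noteq> v" for u
        using that vV A(3) by (intro separatesI[of x]) (auto simp: sm)
    qed (use CV A vV in auto)
    moreover have "card ?C = card C + card A"
    proof -
      have "card ?C = card C + card (insert x (A - {a}))"
        using finC A CV by (intro card_Un_disjoint) auto
      also have "card (insert x (A - {a})) = card A"
        using A(1,4) a card.remove[OF A(1) a] by simp
      finally show ?thesis .
    qed
    ultimately show ?thesis using that by blast
  next
    case False
    then have vU: "v \<notin> U" using c by blast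
    let ?C = "C \<union> A"
    have "almost_code (V \<union> insert x A) (U - {v}) ?C"
    proof (rule almost_code_extend[OF al])
      show "\<exists>d\<in>?C. adjeq t d" if t: "t \<in> insert x A" for t
      proof -
        obtain b where "b \<in> A" "t = x \<or> t = b" using t two[of x] by auto
        then show ?thesis using xa unfolding adjeq_def by blast
      qed
      show "separates ?C t u" if t: "t \<in> insert x A" and u: "u \<in> V" for t u
      proof -
        obtain b where "b \<in> A" "t = x \<or> t = b" using t two[of x] by auto
        then show ?thesis using u by (intro separatesI[of b]) (auto simp: sm)
      qed
      have key: "separates ?C x t" if t: "t \<in> A" for t
      proof -
        obtain b where "b \<in> A" "b \<noteq> t" using two by blast
        then show ?thesis using t by (intro separatesI[of b]) (auto simp: sm)
      qed
      have key2: "separates ?C s t" if "s \<in> A" "t \<in> A" "s \<noteq> t" for s t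
        using that by (intro separatesI'[of t]) (auto simp: sm)
      show "separates ?C s t" if "s \<in> insert x A" "t \<in> insert x A" "s \<noteq> t" for s t
        using that key key2 separates_sym by (metis insertE)
    qed (use CV A vV vU in auto)
    moreover have "card ?C = card C + card A"
      using finC A CV by (intro card_Un_disjoint) auto
    ultimately show ?thesis using that by blast
  qed
qed

text \<open>Coding \<open>y\<close>, whose only old neighbour is \<open>v\<close>, repairs
  \<open>v\<close> in both cases. A coded \<open>v\<close> tells \<open>x\<close> from
  \<open>y\<close>. Otherwise \<open>w\<close> has to do so, and \<open>y\<close> is told from
  \<open>v\<close> by the old code vertex that dominates \<open>v\<close>.\<close>

lemma path_extend:
  assumes al: "almost_code V U C" and fin: "finite V" and vV: "v \<in> V"
    and nV: "w \<notin> V" "x \<notin> V" "y \<notin> V" and ds: "distinct [w, x, y]"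
    and yv: "\<And>u. u \<in> V \<Longrightarrow> E y u \<longleftrightarrow> u = v"
    and wx: "\<And>u. u \<in> V \<Longrightarrow> \<not> E w u" "\<And>u. u \<in> V \<Longrightarrow> \<not> E x u"
    and e: "E w x" "E x y" "\<not> E w y"
  obtains C' where "almost_code (V \<union> {w, x, y}) (U - {v}) C'" "card C' = card C + 2"
proof -
  have CV: "C \<subseteq> V" using al by (simp add: almost_code_def)
  then have finC: "finite C" using fin finite_subset by blast
  have dom: "\<exists>d\<in>C. adjeq u d" if "u \<in> V" for u using al that by (auto simp: almost_code_def)
  have e': "E x w" "E y x" "\<not> E y w" using e E_sym by blast+
  have sy: "E u y \<longleftrightarrow> u = v" "\<not> E u w" "\<not> E u x" if "u \<in> V" for u using wx yv that E_sym by blast+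
  have ne: "u \<noteq> w" "u \<noteq> x" "u \<noteq> y" "w \<noteq> u" "x \<noteq> u" "y \<noteq> u" if "u \<in> V" for u using nV that by auto
  have ds': "w \<noteq> x" "w \<noteq> y" "x \<noteq> y" "x \<noteq> w" "y \<noteq> w" "y \<noteq> x" using ds by auto
  note sm = adjeq_def yv wx e e' sy ne ds'
  show ?thesis
  proof (cases "v \<in> C")
    case True
    let ?C = "C \<union> {x, y}"
    have "almost_code (V \<union> {w, x, y}) (U - {v}) ?C"
    proof (rule almost_code_extend[OF al])
      show "\<exists>d\<in>?C. adjeq t d" if "t \<in> {w, x, y}" for t
        using that by (auto simp: sm)
      show "separates ?C t u" if "t \<in> {w, x, y}" "u \<in> V" for t u
        using that by (intro separatesI[of x]) (auto simp: sm)
      have "separates ?C w x" "separates ?C w y" by (rule separatesI'[of y]; simp add: sm)+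
      moreover have "separates ?C x y" using True vV by (intro separatesI'[of v]) (auto simp: sm)
      ultimately show "separates ?C s t" if "s \<in> {w, x, y}" "t \<in> {w, x, y}" "s \<noteq> t" for s t
        using that separates_sym by blast
      show "separates ?C v u" if "u \<in> V" "u \<noteq> v" for u
        using that vV by (intro separatesI[of y]) (auto simp: sm)
    qed (use CV vV in auto)
    moreover have "card ?C = card C + 2"
      using finC CV nV ds by (subst card_Un_disjoint) auto
    ultimately show ?thesis using that by blast
  next
    case False
    let ?C = "C \<union> {w, y}"
    have "almost_code (V \<union> {w, x, y}) (U - {v}) ?C"
    proof (rule almost_code_extend[OF al])
      show "\<exists>d\<in>?C. adjeq t d" if "t \<in> {w, x, y}" for t
        using that by (auto simp: sm)
      have 1: "separates ?C t u" if "t \<in> {w, x}" "u \<in> V" for t u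
        using that by (intro separatesI[of w]) (auto simp: sm)
      have 2: "separates ?C y u" if "u \<in> V" for u
      proof (cases "u = v")
        case True
        obtain d where "d \<in> C" "adjeq v d" using dom vV by blast
        then show ?thesis using True False CV by (intro separatesI'[of d]) (auto simp: sm)
      next
        case False
        then show ?thesis using that by (intro separatesI[of y]) (auto simp: sm)
      qed
      show "separates ?C t u" if "t \<in> {w, x, y}" "u \<in> V" for t u
        using that 1 2 by blast
      have "separates ?C w x" "separates ?C w y" by (rule separatesI'[of y]; simp add: sm)+
      moreover have "separates ?C x y" by (intro separatesI[of w]) (auto simp: sm)
      ultimately show "separates ?C s t" if "s \<in> {w, x, y}" "t \<in> {w, x, y}" "s \<noteq> t" for s t
        using that separates_sym by blast
      show "separates ?C v u" if "u \<in> V" "u \<noteq> v" for u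
        using that vV by (intro separatesI[of y]) (auto simp: sm)
    qed (use CV vV in auto)
    moreover have "card ?C = card C + 2"
      using finC CV nV ds by (subst card_Un_disjoint) auto
    ultimately show ?thesis using that by blast
  qed
qed

text \<open>Coding \<open>x\<close> repairs \<open>v\<close> in both cases. An uncoded
  \<open>v\<close> is added to the code instead of \<open>b\<close>: then \<open>b\<close> sees
  \<open>v\<close> only, whereas every old vertex is dominated by an old code vertex different from
  \<open>v\<close>.\<close>

lemma fork_extend:
  assumes al: "almost_code V U C" and fin: "finite V" and vV: "v \<in> V"
    and nV: "w \<notin> V" "x \<notin> V" "b \<notin> V" and ds: "distinct [w, x, b]"
    and xv: "\<And>u. u \<in> V \<Longrightarrow> E x u \<longleftrightarrow> u = v" and bv: "\<And>u. u \<in> V \<Longrightarrow> E b u \<longleftrightarrow> u = v"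
    and wv: "\<And>u. u \<in> V \<Longrightarrow> \<not> E w u"
    and e: "E w x" "\<not> E w b" "\<not> E x b"
  obtains C' where "almost_code (V \<union> {w, x, b}) (U - {v}) C'" "card C' = card C + 2"
proof -
  have CV: "C \<subseteq> V" using al by (simp add: almost_code_def)
  then have finC: "finite C" using fin finite_subset by blast
  have dom: "\<exists>d\<in>C. adjeq u d" if "u \<in> V" for u using al that by (auto simp: almost_code_def)
  have e': "E x w" "\<not> E b w" "\<not> E b x" using e E_sym by blast+
  have sy: "E u x \<longleftrightarrow> u = v" "\<not> E u w" "E u b \<longleftrightarrow> u = v" if "u \<in> V" for u
    using wv xv bv that E_sym by blast+
  have ne: "u \<noteq> w" "u \<noteq> x" "u \<noteq> b" "w \<noteq> u" "x \<noteq> u" "b \<noteq> u" if "u \<in> V" for u using nV that by auto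
  have ds': "w \<noteq> x" "w \<noteq> b" "x \<noteq> b" "x \<noteq> w" "b \<noteq> w" "b \<noteq> x" using ds by auto
  note sm = adjeq_def xv bv wv e e' sy ne ds'
  show ?thesis
  proof (cases "v \<in> C")
    case True
    let ?C = "C \<union> {x, b}"
    have "almost_code (V \<union> {w, x, b}) (U - {v}) ?C"
    proof (rule almost_code_extend[OF al])
      show "\<exists>d\<in>?C. adjeq t d" if "t \<in> {w, x, b}" for t
        using that by (auto simp: sm)
      show "separates ?C t u" if "t \<in> {w, x, b}" "u \<in> V" for t u
      proof (cases "u = v")
        case False
        then show ?thesis using that by (auto simp: separates_def sm)
      next
        case True
        then show ?thesis using that
          by (cases "t = b") (auto intro: separatesI'[of x] separatesI'[of b] simp: sm)
      qed
      have "separates ?C w x" "separates ?C w b" using True vV by (auto intro!: separatesI'[of v] simp: sm)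
      moreover have "separates ?C x b" by (intro separatesI[of x]) (auto simp: sm)
      ultimately show "separates ?C s t" if "s \<in> {w, x, b}" "t \<in> {w, x, b}" "s \<noteq> t" for s t
        using that separates_sym by blast
      show "separates ?C v u" if "u \<in> V" "u \<noteq> v" for u
        using that vV by (intro separatesI[of x]) (auto simp: sm)
    qed (use CV vV in auto)
    moreover have "card ?C = card C + 2"
      using finC CV nV ds by (subst card_Un_disjoint) auto
    ultimately show ?thesis using that by blast
  next
    case False
    let ?C = "C \<union> {v, x}"
    have old: "\<exists>d\<in>C. d \<noteq> v \<and> d \<in> V \<and> adjeq u d" if "u \<in> V" for u
      using dom[OF that] False CV by (metis subsetD)
    have "almost_code (V \<union> {w, x, b}) (U - {v}) ?C"
    proof (rule almost_code_extend[OF al])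
      show "\<exists>d\<in>?C. adjeq t d" if "t \<in> {w, x, b}" for t
        using that vV by (auto simp: sm)
      have b: "separates ?C b u" if u: "u \<in> V" for u
      proof -
        obtain d where "d \<in> C" "d \<noteq> v" "d \<in> V" "adjeq u d" using old u by blast
        then show ?thesis by (intro separatesI'[of d]) (auto simp: sm)
      qed
      have x: "separates ?C x u" if u: "u \<in> V" for u
      proof (cases "u = v")
        case True
        obtain d where "d \<in> C" "d \<noteq> v" "d \<in> V" "adjeq u d" using old u by blast
        then show ?thesis by (intro separatesI'[of d]) (auto simp: sm)
      next
        case False
        then show ?thesis using u by (intro separatesI[of x]) (auto simp: sm)
      qed
      have w: "separates ?C w u" if u: "u \<in> V" for u
      proof (cases "u = v")
        case True
        then show ?thesis using vV by (intro separatesI'[of v]) (auto simp: sm)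
      next
        case False
        then show ?thesis using u by (intro separatesI[of x]) (auto simp: sm)
      qed
      show "separates ?C t u" if "t \<in> {w, x, b}" "u \<in> V" for t u
        using that b x w by blast
      have "separates ?C w x" "separates ?C w b" using vV by (auto intro!: separatesI'[of v] simp: sm)
      moreover have "separates ?C x b" by (intro separatesI[of x]) (auto simp: sm)
      ultimately show "separates ?C s t" if "s \<in> {w, x, b}" "t \<in> {w, x, b}" "s \<noteq> t" for s t
        using that separates_sym by blast
      show "separates ?C v u" if "u \<in> V" "u \<noteq> v" for u
        using that vV by (intro separatesI[of x]) (auto simp: sm)
    qed (use CV vV in auto)
    moreover have "card ?C = card C + 2"
    proof -
      have "card ?C = card C + card {v, x}" using finC CV nV False by (intro card_Un_disjoint) auto
      moreover have "v \<noteq> x" using vV nV by blast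
      ultimately show ?thesis by simp
    qed
    ultimately show ?thesis using that by blast
  qed
qed

text \<open>The coded \<open>v\<close> tells \<open>x\<close> from \<open>w\<close>, so two new
  vertices cost a single code vertex. In exchange \<open>v\<close> gets no new code neighbour and
  cannot be repaired.\<close>

lemma edge_extend:
  assumes al: "almost_code V U C" and fin: "finite V" and vV: "v \<in> V" "v \<in> C"
    and nV: "w \<notin> V" "x \<notin> V"
    and xv: "\<And>u. u \<in> V \<Longrightarrow> E x u \<longleftrightarrow> u = v" and wv: "\<And>u. u \<in> V \<Longrightarrow> \<not> E w u"
    and e: "E w x" and vU: "v \<notin> U"
  obtains C' where "almost_code (V \<union> {w, x}) U C'" "card C' = card C + 1"
proof -
  have CV: "C \<subseteq> V" using al by (simp add: almost_code_def)
  then have finC: "finite C" using fin finite_subset by blast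
  have e': "E x w" using e E_sym by blast+
  have sy: "E u x \<longleftrightarrow> u = v" "\<not> E u w" if "u \<in> V" for u
    using wv xv that E_sym by blast+
  have ne: "u \<noteq> w" "u \<noteq> x" "w \<noteq> u" "x \<noteq> u" if "u \<in> V" for u using nV that by auto
  note sm = adjeq_def xv wv e e' sy ne
  let ?C = "insert w C"
  have "almost_code (V \<union> {w, x}) (U - {v}) ?C"
  proof (rule almost_code_extend[OF al])
    show "\<exists>d\<in>?C. adjeq t d" if "t \<in> {w, x}" for t
      using that by (auto simp: sm)
    show "separates ?C t u" if "t \<in> {w, x}" "u \<in> V" for t u
      using that by (intro separatesI[of w]) (auto simp: sm)
    have "separates ?C w x" using vV by (intro separatesI'[of v]) (auto simp: sm)
    then show "separates ?C s t" if "s \<in> {w, x}" "t \<in> {w, x}" "s \<noteq> t" for s t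
      using that separates_sym by blast
  qed (use CV vV vU in auto)
  moreover have "w \<notin> C" using CV nV by blast
  then have "card ?C = card C + 1" using finC by simp
  moreover have "U - {v} = U" using vU by blast
  ultimately show ?thesis using that by simp
qed

end

section \<open>End configurations of trees\<close>

context sgraph begin

definition nbrs :: "'a set \<Rightarrow> 'a \<Rightarrow> 'a set" where
  "nbrs V u = {w\<in>V. E u w}"

text \<open>Connectedness is reachability inside \<open>V\<close>, which suits closure arguments and
  the deletion of vertices better than lists of vertices do.\<close>

definition subtree :: "'a set \<Rightarrow> bool" where
  "subtree V \<longleftrightarrow> finite V \<and> V \<noteq> {} \<and> \<not> has_cycle V E \<and>
     (\<forall>u\<in>V. \<forall>v\<in>V. (\<lambda>a b. E a b \<and> a \<in> V \<and> b \<in> V)\<^sup>*\<^sup>* u v)"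

text \<open>Nothing is demanded of \<open>y\<close>: it is the vertex at which the star is cut off,
  and it is a leaf itself if the whole tree is a star.\<close>

definition end_star :: "'a set \<Rightarrow> 'a \<Rightarrow> 'a \<Rightarrow> bool" where
  "end_star V x y \<longleftrightarrow> x \<in> V \<and> y \<in> V \<and> E x y \<and> 3 \<le> card (nbrs V x) \<and>
     (\<forall>u\<in>nbrs V x - {y}. nbrs V u = {x})"

lemma nbrs_iff: "w \<in> nbrs V u \<longleftrightarrow> w \<in> V \<and> E u w"
  by (simp add: nbrs_def)

lemma walk_single: "walk V E [u] \<longleftrightarrow> u \<in> V"
  by (simp add: walk_def)

lemma walk_Cons: "walk V E (u # v # p) \<longleftrightarrow> u \<in> V \<and> E u v \<and> walk V E (v # p)"
proof -
  have "(\<forall>i. Suc i < length (u # v # p) \<longrightarrow> E ((u # v # p) ! i) ((u # v # p) ! Suc i)) \<longleftrightarrow>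
      E u v \<and> (\<forall>i. Suc i < length (v # p) \<longrightarrow> E ((v # p) ! i) ((v # p) ! Suc i))"
    by (auto simp: nth_Cons split: nat.split)
  then show ?thesis by (auto simp: walk_def)
qed

lemma walk_hd: "walk V E (u # p) \<Longrightarrow> u \<in> V"
  by (simp add: walk_def)

lemma walk_subset: "walk V E p \<Longrightarrow> V \<subseteq> W \<Longrightarrow> walk W E p"
  by (auto simp: walk_def)

lemma no_cycle_subset: "\<not> has_cycle W E \<Longrightarrow> V \<subseteq> W \<Longrightarrow> \<not> has_cycle V E"
  using walk_subset unfolding has_cycle_def by blast

lemma walk_rtranclp:
  "walk V E p \<Longrightarrow> (\<lambda>a b. E a b \<and> a \<in> V \<and> b \<in> V)\<^sup>*\<^sup>* (hd p) (last p)"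
proof (induction p rule: induct_list012)
  case (3 u v p)
  then have "E u v \<and> u \<in> V \<and> v \<in> V" "walk V E (v # p)" unfolding walk_Cons
    by (auto simp: walk_def)
  with 3 show ?case by (auto intro: converse_rtranclp_into_rtranclp)
qed (auto simp: walk_def)

lemma tree_imp_subtree:
  assumes "tree V E"
  shows "subtree V"
proof -
  have "(\<lambda>a b. E a b \<and> a \<in> V \<and> b \<in> V)\<^sup>*\<^sup>* u v" if uv: "u \<in> V" "v \<in> V" for u v
  proof -
    obtain p where "walk V E p" "hd p = u" "last p = v"
      using assms uv by (auto simp: tree_def connected_graph_def)
    then show ?thesis using walk_rtranclp[of V p] by simp
  qed
  then show ?thesis using assms by (auto simp: tree_def subtree_def graph_def)
qed

lemma subtree_closed:
  assumes "subtree V" "S \<subseteq> V" "S \<noteq> {}" "\<And>s t. s \<in> S \<Longrightarrow> t \<in> V \<Longrightarrow> E s t \<Longrightarrow> t \<in> S"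
  shows "S = V"
proof -
  obtain s where s: "s \<in> S" using assms by blast
  have "t \<in> S" if t: "t \<in> V" for t
  proof -
    have "(\<lambda>a b. E a b \<and> a \<in> V \<and> b \<in> V)\<^sup>*\<^sup>* s t" using assms s t by (auto simp: subtree_def)
    then show ?thesis using s assms(4) by induction auto
  qed
  then show ?thesis using assms(2) by blast
qed

text \<open>Collapsing \<open>X\<close> onto \<open>v\<close> maps each edge of \<open>V\<close> to
  an edge of \<open>V - X\<close> or to a single vertex, so connections in \<open>V\<close> retract
  into \<open>V - X\<close>.\<close>

lemma subtree_cut:
  assumes "subtree V" "v \<in> V - X" "\<And>t u. t \<in> X \<Longrightarrow> u \<in> V - X \<Longrightarrow> E t u \<Longrightarrow> u = v"
  shows "subtree (V - X)"
proof -
  let ?R = "\<lambda>W a b. E a b \<and> a \<in> W \<and> b \<in> W"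
  define f where "f t = (if t \<in> X then v else t)" for t
  have step_lift: "(?R (V - X))\<^sup>*\<^sup>* (f a) (f b)" if "?R V a b" for a b
  proof (cases "f a = f b")
    case False
    then have "?R (V - X) (f a) (f b)"
      using that assms(2) assms(3)[of a b] assms(3)[of b a] E_sym[of a b] unfolding f_def
      by (metis Diff_iff)
    then show ?thesis by blast
  qed simp
  have lift: "(?R (V - X))\<^sup>*\<^sup>* (f a) (f b)" if "(?R V)\<^sup>*\<^sup>* a b" for a b
    using that
  proof induction
    case (step y z)
    then show ?case using step_lift[of y z] rtranclp_trans[of "?R (V - X)" "f a" "f y" "f z"] by blast
  qed blast
  have "(?R (V - X))\<^sup>*\<^sup>* a b" if ab: "a \<in> V - X" "b \<in> V - X" for a b
  proof -
    have "(?R V)\<^sup>*\<^sup>* a b" using assms(1) ab unfolding subtree_def by blast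
    then show ?thesis using lift ab by (fastforce simp: f_def)
  qed
  then show ?thesis using assms(1,2) no_cycle_subset[of V "V - X"] unfolding subtree_def by auto
qed

text \<open>Otherwise the initial segment of \<open>p\<close> ending in \<open>u\<close> is closed
  to a cycle by the edge from \<open>u\<close> to the head; excluding the second vertex makes the
  segment long enough.\<close>

lemma no_back_edge:
  assumes nc: "\<not> has_cycle V E" and p: "walk V E p" "distinct p" and u: "E u (hd p)" "2 \<le> length p \<Longrightarrow> u \<noteq> p ! 1"
  shows "u \<notin> set p"
proof
  assume "u \<in> set p"
  then obtain j where j: "j < length p" "u = p ! j" by (auto simp: in_set_conv_nth)
  have "p \<noteq> []" using p by (simp add: walk_def)
  then have "j \<noteq> 0" using u(1) j E_irrefl[of u] hd_conv_nth[of p] by (intro notI) simp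
  moreover have "j \<noteq> 1" using u(2) j by auto
  ultimately have j2: "2 \<le> j" by simp
  let ?q = "take (Suc j) p"
  have "walk V E ?q" using p by (auto simp: walk_def dest: in_set_takeD)
  moreover have "distinct ?q" using p by simp
  moreover have "length ?q \<ge> 3" using j j2 by simp
  moreover have "last ?q = u" using j by (simp add: take_Suc_conv_app_nth)
  moreover have "hd ?q = hd p" by simp
  ultimately show False using nc u(1) unfolding has_cycle_def by metis
qed

section \<open>Longest paths and the shape of a tree at their ends\<close>

definition longest :: "'a set \<Rightarrow> 'a list \<Rightarrow> bool" where
  "longest V p \<longleftrightarrow> walk V E p \<and> distinct p \<and>
     (\<forall>q. walk V E q \<longrightarrow> distinct q \<longrightarrow> length q \<le> length p)"

lemma longest_exists:
  assumes "finite V" "V \<noteq> {}"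
  obtains p where "longest V p"
proof -
  let ?P = "\<lambda>q. walk V E q \<and> distinct q"
  obtain u where "u \<in> V" using assms by blast
  then have 1: "?P [u]" by (simp add: walk_single)
  have 2: "length q < Suc (card V)" if "?P q" for q
  proof -
    have "card (set q) \<le> card V" using that assms by (intro card_mono) (auto simp: walk_def)
    then show ?thesis using that by (simp add: distinct_card)
  qed
  obtain p where "?P p \<and> (\<forall>q. ?P q \<longrightarrow> length q \<le> length p)"
    using ex_has_greatest_nat[of ?P "[u]" length] 1 2 by blast
  then show ?thesis using that unfolding longest_def by blast
qed

lemma longest_hd_leaf:
  assumes nc: "\<not> has_cycle V E" and p: "longest V (u # v # p)"
  shows "nbrs V u = {v}"
proof -
  have w: "walk V E (u # v # p)" "distinct (u # v # p)" using p by (auto simp: longest_def)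
  have "t = v" if t: "t \<in> V" "E u t" for t
  proof (rule ccontr)
    assume "t \<noteq> v"
    then have "t \<notin> set (u # v # p)"
      using no_back_edge[OF nc w] t E_sym by simp
    then have "walk V E (t # u # v # p)" "distinct (t # u # v # p)"
      using w t E_sym by (auto simp: walk_Cons)
    then show False using p unfolding longest_def by fastforce
  qed
  moreover have "v \<in> V" "E u v" using w walk_hd by (auto simp: walk_Cons)
  ultimately show ?thesis unfolding nbrs_def by blast
qed

text \<open>The exchanged path has the same length, hence is longest again. Together with
  \<open>longest_hd_leaf\<close> this makes every neighbour of \<open>v\<close> other than
  \<open>t\<close> a leaf.\<close>

lemma longest_swap_hd:
  assumes nc: "\<not> has_cycle V E" and p: "longest V (u # v # t # p)" and s: "s \<in> V" "E v s" "s \<noteq> t"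
  shows "longest V (s # v # t # p)"
proof -
  have w: "walk V E (v # t # p)" "distinct (v # t # p)" using p by (auto simp: longest_def walk_Cons)
  have "s \<notin> set (v # t # p)" using no_back_edge[OF nc w] s E_sym by simp
  then show ?thesis using p w s E_sym unfolding longest_def by (auto simp: walk_Cons)
qed

lemma longest_length:
  assumes "subtree V" "3 \<le> card V" "longest V p"
  shows "3 \<le> length p"
proof (rule ccontr)
  assume n: "\<not> ?thesis"
  have nc: "\<not> has_cycle V E" and pw: "walk V E p" "distinct p"
    using assms by (auto simp: subtree_def longest_def)
  have "p \<noteq> []" using pw by (simp add: walk_def)
  then consider u where "p = [u]" | u v where "p = [u, v]"
  proof -
    obtain u q where p: "p = u # q" using \<open>p \<noteq> []\<close> by (cases p) auto
    show ?thesis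
    proof (cases q)
      case Nil
      then show ?thesis using p that by blast
    next
      case (Cons v r)
      then have "r = []" using n p by (cases r) auto
      then show ?thesis using p Cons that by blast
    qed
  qed
  then show False
  proof cases
    case 1
    have "t \<in> {u}" if "t \<in> V" "E u t" for t
    proof (rule ccontr)
      assume "t \<notin> {u}"
      then have "walk V E [t, u] \<and> distinct [t, u]" using that pw 1 E_sym by (auto simp: walk_Cons)
      then show False using assms(3) 1 unfolding longest_def by fastforce
    qed
    then have "{u} = V" using pw 1 by (intro subtree_closed[OF assms(1)]) (auto simp: walk_def)
    then show False using assms(2) by auto
  next
    case 2
    have "E u v" using pw 2 by (simp add: walk_Cons)
    then have "longest V [v, u]" using assms(3) 2 E_sym unfolding longest_def by (auto simp: walk_Cons walk_single)
    then have "nbrs V u = {v}" "nbrs V v = {u}" using longest_hd_leaf[OF nc] assms(3) 2 by auto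
    then have "{u, v} = V" using pw 2
      by (intro subtree_closed[OF assms(1)]) (auto simp: walk_def nbrs_def set_eq_iff)
    moreover have "card {u, v} \<le> 2" by (simp add: card_insert_if)
    ultimately have "card V \<le> 2" by simp
    then show False using assms(2) by simp
  qed
qed

text \<open>No branch near the end of a longest path is longer than the end itself. So the
  neighbours of \<open>x\<close> other than \<open>y\<close> are leaves, and the absence of end
  stars leaves only \<open>w\<close> among them; the same argument applies to a non-leaf branch at
  \<open>y\<close> off the path. The cases differ only in how the tree continues at
  \<open>y\<close>.\<close>

lemma end_structure:
  assumes st: "subtree V" and c3: "3 \<le> card V" and no: "\<And>x y. \<not> end_star V x y"
  obtains
    (P3) w x y where "V = {w, x, y}" "distinct [w, x, y]" "E w x" "E x y" "\<not> E w y"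
  | (double) w x y w' x' where "distinct [w, x, y, w', x']" "{w, x, y, w', x'} \<subseteq> V"
      "nbrs V w = {x}" "nbrs V x = {w, y}" "nbrs V w' = {x'}" "nbrs V x' = {w', y}"
  | (fork) w x y b where "distinct [w, x, y, b]" "{w, x, y, b} \<subseteq> V"
      "nbrs V w = {x}" "nbrs V x = {w, y}" "nbrs V b = {y}"
  | (path) w x y z where "distinct [w, x, y, z]" "{w, x, y, z} \<subseteq> V"
      "nbrs V w = {x}" "nbrs V x = {w, y}" "nbrs V y = {x, z}"
proof -
  have nc: "\<not> has_cycle V E" and fin: "finite V" "V \<noteq> {}" using st by (auto simp: subtree_def)
  obtain p where p: "longest V p" using longest_exists fin .
  then have "3 \<le> length p" using longest_length st c3 by blast
  then obtain w x y q where pe: "p = w # x # y # q"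
    by (metis One_nat_def Suc_le_length_iff numeral_3_eq_3)
  note L = p[unfolded pe]
  have wk: "walk V E (w # x # y # q)" "distinct (w # x # y # q)" using L by (auto simp: longest_def)
  have inV: "w \<in> V" "x \<in> V" "y \<in> V" and e: "E w x" "E x y" using wk by (auto simp: walk_Cons walk_def)
  \<comment> \<open>All neighbours of \<open>v\<close> except possibly \<open>t\<close> are leaves,
    so a third neighbour would turn \<open>v\<close> into the centre of an end star.\<close>
  have two: "nbrs V v = {s, t}" if "s \<in> V" "t \<in> V" "E v s" "E v t" "v \<in> V" "s \<noteq> t"
    "\<And>u. u \<in> V \<Longrightarrow> E v u \<Longrightarrow> u \<noteq> t \<Longrightarrow> nbrs V u = {v}" for v s t
  proof -
    have "\<not> 3 \<le> card (nbrs V v)"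
      using no[of v t] that unfolding end_star_def by (auto simp: nbrs_iff)
    then have "card (nbrs V v) \<le> card {s, t}" using that(6) by simp
    moreover have "{s, t} \<subseteq> nbrs V v" using that by (auto simp: nbrs_def)
    ultimately show ?thesis using fin card_seteq[of "nbrs V v" "{s, t}"] by (auto simp: nbrs_def)
  qed
  have Nw: "nbrs V w = {x}" using longest_hd_leaf[OF nc L] .
  have Nx: "nbrs V x = {w, y}"
  proof (rule two)
    show "nbrs V u = {x}" if "u \<in> V" "E x u" "u \<noteq> y" for u
      using longest_hd_leaf[OF nc longest_swap_hd[OF nc L that]] .
  qed (use inV e E_sym wk in auto)
  show ?thesis
  proof (cases q)
    case Nil
    then have "longest V [y, x, w]"
      using L E_sym unfolding longest_def by (auto simp: walk_Cons walk_single)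
    then have Ny: "nbrs V y = {x}" using longest_hd_leaf[OF nc] by blast
    have "{w, x, y} = V"
    proof (rule subtree_closed[OF st])
      show "t \<in> {w, x, y}" if "s \<in> {w, x, y}" "t \<in> V" "E s t" for s t
        using that Nw Nx Ny by (auto simp: nbrs_def set_eq_iff)
    qed (use inV in auto)
    moreover have "\<not> E w y" using Nw inV wk nbrs_iff[of y V w] by auto
    ultimately show ?thesis using P3[of w x y] wk e by auto
  next
    case (Cons z r)
    have wk': "walk V E (y # z # r)" "distinct (y # z # r)" and ds: "distinct [w, x, y, z]"
      using wk Cons by (auto simp: walk_Cons)
    have zV: "z \<in> V" "E y z" using wk'(1) walk_hd unfolding walk_Cons by blast+
    show ?thesis
    proof (cases "\<exists>u. u \<in> V \<and> E y u \<and> u \<noteq> x \<and> u \<noteq> z")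
      case False
      then have "nbrs V y = {x, z}" using inV e zV E_sym by (auto simp: nbrs_def)
      then show ?thesis using path[of w x y z] ds inV zV Nw Nx by auto
    next
      case True
      then obtain u where u: "u \<in> V" "E y u" "u \<noteq> x" "u \<noteq> z" by blast
      have "u \<noteq> y" using u E_irrefl by blast
      moreover have "u \<noteq> w" using u Nw inV wk E_sym[of y u] nbrs_iff[of y V w] by auto
      ultimately have dsu: "distinct [w, x, y, u]" using ds u by auto
      show ?thesis
      proof (cases "nbrs V u = {y}")
        case True
        then show ?thesis using fork[of w x y u] dsu inV u Nw Nx by auto
      next
        case False
        then obtain s where s: "s \<in> V" "E u s" "s \<noteq> y" using u inV E_sym by (auto simp: nbrs_def)
        have "u \<notin> set (y # z # r)" using no_back_edge[OF nc wk'] u E_sym by simp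
        then have wu: "walk V E (u # y # z # r)" "distinct (u # y # z # r)"
          using wk' u E_sym by (auto simp: walk_Cons)
        \<comment> \<open>The branch \<open>t\<close>, \<open>u\<close> at \<open>y\<close> is as
          long as \<open>w\<close>, \<open>x\<close>, so it may replace the end of the longest
          path.\<close>
        have long: "longest V (t # u # y # z # r)" if t: "t \<in> V" "E u t" "t \<noteq> y" for t
        proof -
          have "t \<notin> set (u # y # z # r)" using no_back_edge[OF nc wu] t E_sym by simp
          then show ?thesis using wu t E_sym L Cons unfolding longest_def by (auto simp: walk_Cons)
        qed
        have leaf: "nbrs V t = {u}" if "t \<in> V" "E u t" "t \<noteq> y" for t
          using longest_hd_leaf[OF nc long[OF that]] .
        have "nbrs V u = {s, y}" by (rule two) (use s u inV E_sym leaf in auto)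
        moreover have "nbrs V s = {u}" using leaf s by blast
        moreover have "s \<noteq> w" "s \<noteq> x" using \<open>nbrs V s = {u}\<close> Nw Nx u dsu by auto
        moreover have "s \<noteq> u" using s E_irrefl by blast
        ultimately show ?thesis using double[of w x y s u] dsu s u inV Nw Nx by auto
      qed
    qed
  qed
qed

end

section \<open>Trees with hung 3-stars\<close>

context sgraph begin

text \<open>This is the operation of appending a 3-star onto \<open>v\<close>, read off inside the
  fixed graph instead of being constructed.\<close>

definition pendant3 :: "'a set \<Rightarrow> 'a \<Rightarrow> 'a \<Rightarrow> 'a \<Rightarrow> 'a \<Rightarrow> bool" where
  "pendant3 V v x a b \<longleftrightarrow> v \<in> V \<and> x \<notin> V \<and> a \<notin> V \<and> b \<notin> V \<and> distinct [x, a, b] \<and>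
     (\<forall>u\<in>V. E x u \<longleftrightarrow> u = v) \<and> (\<forall>u\<in>V. \<not> E a u \<and> \<not> E b u) \<and> E x a \<and> E x b \<and> \<not> E a b"

text \<open>In contrast to \<open>appended3\<close>, stars are hung at vertices of \<open>Z\<close>
  only. For \<open>Z \<subseteq> K\<close> they never hang on one another, so their order can be
  changed freely.\<close>

inductive hung :: "'a set \<Rightarrow> 'a set \<Rightarrow> 'a set \<Rightarrow> bool" for K Z where
  core: "hung K Z K"
| hang: "hung K Z V \<Longrightarrow> v \<in> Z \<Longrightarrow> pendant3 V v x a b \<Longrightarrow> hung K Z (V \<union> {x, a, b})"

lemma pendant3_swap: "pendant3 V v x a b \<Longrightarrow> pendant3 V v x b a"
  unfolding pendant3_def using E_sym by auto

lemma pendant3_subset: "pendant3 W t y c d \<Longrightarrow> V \<subseteq> W \<Longrightarrow> t \<in> V \<Longrightarrow> pendant3 V t y c d"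
  unfolding pendant3_def by blast

lemma pendant3_edges:
  assumes "pendant3 V v x a b"
  shows "x \<noteq> a" "x \<noteq> b" "a \<noteq> b" "a \<noteq> x" "b \<noteq> x" "b \<noteq> a" "E x a" "E x b" "E a x" "E b x" "\<not> E a b" "\<not> E b a"
    "E x v" "E v x"
    "\<And>u. u \<in> V \<Longrightarrow> u \<noteq> x" "\<And>u. u \<in> V \<Longrightarrow> u \<noteq> a" "\<And>u. u \<in> V \<Longrightarrow> u \<noteq> b"
    "\<And>u. u \<in> V \<Longrightarrow> x \<noteq> u" "\<And>u. u \<in> V \<Longrightarrow> a \<noteq> u" "\<And>u. u \<in> V \<Longrightarrow> b \<noteq> u"
    "\<And>u. u \<in> V \<Longrightarrow> E x u \<longleftrightarrow> u = v" "\<And>u. u \<in> V \<Longrightarrow> E u x \<longleftrightarrow> u = v"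
    "\<And>u. u \<in> V \<Longrightarrow> \<not> E a u" "\<And>u. u \<in> V \<Longrightarrow> \<not> E b u" "\<And>u. u \<in> V \<Longrightarrow> \<not> E u a" "\<And>u. u \<in> V \<Longrightarrow> \<not> E u b"
  using assms E_sym unfolding pendant3_def by (simp; blast)+

text \<open>The condition \<open>t \<in> V\<close> keeps the second star off the first one; this is
  what lets the two be hung in either order.\<close>

lemma pendant3_exchange:
  assumes "pendant3 V s x a b" "pendant3 (V \<union> {x, a, b}) t y c d" "t \<in> V"
  shows "pendant3 V t y c d" "pendant3 (V \<union> {y, c, d}) s x a b"
proof -
  show "pendant3 V t y c d" using pendant3_subset[OF assms(2) _ assms(3)] by blast
  have "x \<noteq> t" "a \<noteq> t" "b \<noteq> t" using assms(1,3) unfolding pendant3_def by blast+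
  moreover have "s \<in> V" using assms(1) unfolding pendant3_def by blast
  moreover have "distinct [x, a, b]" using assms(1) unfolding pendant3_def by blast
  ultimately show "pendant3 (V \<union> {y, c, d}) s x a b"
    using pendant3_edges[OF assms(1)] pendant3_edges(15-26)[OF assms(2)] unfolding pendant3_def by auto
qed

lemma pendant3_card: "finite V \<Longrightarrow> pendant3 V v x a b \<Longrightarrow> card (V \<union> {x, a, b}) = card V + 3"
  by (auto simp: pendant3_def)

lemma hung_subset: "hung K Z V \<Longrightarrow> K \<subseteq> V"
  by (induction rule: hung.induct) auto

lemma hung_finite: "hung K Z V \<Longrightarrow> finite K \<Longrightarrow> finite V"
  by (induction rule: hung.induct) auto

lemma hung_mono: "hung K Z V \<Longrightarrow> Z \<subseteq> Z' \<Longrightarrow> hung K Z' V"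
  by (induction rule: hung.induct) (blast intro: hung.intros)+

text \<open>Moves one chosen star into the core, so that an explicit code of core and star can be
  extended over all the other stars.\<close>

lemma hung_hang_before:
  assumes "hung K Z V" "Z \<subseteq> K" "pendant3 V s x a b" "s \<in> Z"
  shows "hung (K \<union> {x, a, b}) Z (V \<union> {x, a, b})"
  using assms(1,3)
proof (induction rule: hung.induct)
  case core
  then show ?case by (simp add: hung.core)
next
  case (hang V v y c d)
  have "s \<in> V" "v \<in> V" using hung_subset hang.hyps assms by blast+
  then have ex: "pendant3 V s x a b" "pendant3 (V \<union> {x, a, b}) v y c d"
    using pendant3_exchange hang.hyps hang.prems by blast+
  then have "hung (K \<union> {x, a, b}) Z (V \<union> {x, a, b} \<union> {y, c, d})"
    using ex(2) hang.IH[OF ex(1)] hang.hyps(2) hung.hang by blast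
  then show ?case by (simp add: Un_ac)
qed

text \<open>Hung stars commute, so the star through \<open>u\<close> may be taken as the last
  one.\<close>

lemma hung_pull:
  assumes "hung K Z V" "Z \<subseteq> K" "u \<in> V - K"
  obtains W v x a b where "V = W \<union> {x, a, b}" "hung K Z W" "v \<in> Z" "pendant3 W v x a b" "u \<in> {x, a, b}"
proof -
  have "\<exists>W v x a b. V = W \<union> {x, a, b} \<and> hung K Z W \<and> v \<in> Z \<and> pendant3 W v x a b \<and> u \<in> {x, a, b}"
    using assms(1,3)
  proof (induction rule: hung.induct)
    case (hang V t y c d)
    show ?case
    proof (cases "u \<in> {y, c, d}")
      case True
      then show ?thesis using hang by blast
    next
      case False
      then obtain W v x a b where 1: "V = W \<union> {x, a, b}" "hung K Z W" "v \<in> Z" "pendant3 W v x a b" "u \<in> {x, a, b}"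
        using hang by blast
      have "t \<in> W" using hung_subset[OF 1(2)] hang.hyps(2) assms(2) by blast
      then have "pendant3 W t y c d" "pendant3 (W \<union> {y, c, d}) v x a b"
        using pendant3_exchange 1 hang.hyps by blast+
      moreover have "hung K Z (W \<union> {y, c, d})" using calculation hang.hyps(2) 1(2) by (intro hung.hang)
      moreover have "V \<union> {y, c, d} = W \<union> {y, c, d} \<union> {x, a, b}" using 1(1) by (simp add: Un_ac)
      ultimately show ?thesis using 1(3,5)
        by (intro exI[of _ "W \<union> {y, c, d}"] exI[of _ v] exI[of _ x] exI[of _ a] exI[of _ b] conjI)
    qed
  qed simp
  then show ?thesis using that by blast
qed

lemma hung_pull_other:
  assumes "hung K Z V" "Z \<subseteq> K" "l \<in> Z" "\<not> hung K {l} V"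
  obtains W v x a b where "V = W \<union> {x, a, b}" "hung K Z W" "v \<in> Z" "v \<noteq> l" "pendant3 W v x a b"
proof -
  have "hung K {l} V \<or> (\<exists>W v x a b. V = W \<union> {x, a, b} \<and> hung K Z W \<and> v \<in> Z \<and> v \<noteq> l \<and> pendant3 W v x a b)"
    using assms(1)
  proof (induction rule: hung.induct)
    case core
    then show ?case by (simp add: hung.core)
  next
    case (hang V t y c d)
    show ?case
    proof (cases "t = l")
      case False
      then show ?thesis using hang by blast
    next
      case t: True
      show ?thesis
      proof (cases "hung K {l} V")
        case True
        then have "hung K {l} (V \<union> {y, c, d})" using hang t by (intro hung.hang) auto
        then show ?thesis by blast
      next
        case False
        then obtain W v x a b where 1: "V = W \<union> {x, a, b}" "hung K Z W" "v \<in> Z" "v \<noteq> l" "pendant3 W v x a b"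
          using hang by blast
        have "t \<in> W" using hung_subset[OF 1(2)] hang.hyps(2) assms(2) by blast
        then have "pendant3 W t y c d" "pendant3 (W \<union> {y, c, d}) v x a b"
          using pendant3_exchange 1 hang.hyps by blast+
        moreover have "hung K Z (W \<union> {y, c, d})" using calculation hang.hyps(2) 1(2) by (intro hung.hang)
        moreover have "V \<union> {y, c, d} = W \<union> {y, c, d} \<union> {x, a, b}" using 1(1) by (simp add: Un_ac)
        ultimately show ?thesis using 1(3,4)
          by (intro disjI2 exI[of _ "W \<union> {y, c, d}"] exI[of _ v] exI[of _ x] exI[of _ a] exI[of _ b] conjI)
      qed
    qed
  qed
  then show ?thesis using that assms(4) by blast
qed

lemma pendant3_extend:
  assumes "almost_code V U C" "finite V" "pendant3 V v x a b" "v \<in> C \<or> v \<notin> U"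
  obtains C' where "almost_code (V \<union> {x, a, b}) (U - {v}) C'" "C \<subseteq> C'" "card C' = card C + 2"
proof -
  have p: "v \<in> V" "x \<notin> V" "a \<notin> V" "b \<notin> V" "distinct [x, a, b]" "\<And>u. u \<in> V \<Longrightarrow> E x u \<longleftrightarrow> u = v"
    "\<And>u. u \<in> V \<Longrightarrow> \<not> E a u \<and> \<not> E b u" "E x a" "E x b" "\<not> E a b" "\<not> E b a"
    using assms(3) E_sym unfolding pendant3_def by blast+
  show ?thesis
  proof (rule star_extend[OF assms(1,2) p(1), of "{a, b}" x])
    show "\<not> E s u" if "s \<in> {a, b}" "u \<in> V \<union> {a, b}" for s u
      using that p(7,10,11) E_irrefl by blast
  qed (use p assms that in auto)
qed

text \<open>Each star brings three vertices and two code vertices, so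
  \<open>3 * card C - 2 * card V\<close> does not change. The condition
  \<open>U \<subseteq> C\<close> provides what a star with two new leaves demands when it is hung at
  a vertex of \<open>U\<close>.\<close>

lemma hung_extend:
  assumes "hung K Z V" "finite K" "almost_code K U C" "U \<subseteq> C" "Z \<subseteq> K"
  obtains C' where "almost_code V U C'" "C \<subseteq> C'" "3 * card C' + 2 * card K = 3 * card C + 2 * card V"
proof -
  have "\<exists>C'. almost_code V U C' \<and> C \<subseteq> C' \<and> 3 * card C' + 2 * card K = 3 * card C + 2 * card V"
    using assms(1)
  proof (induction rule: hung.induct)
    case core
    then show ?case using assms(3) by blast
  next
    case (hang V v x a b)
    then obtain C' where C': "almost_code V U C'" "C \<subseteq> C'"
      "3 * card C' + 2 * card K = 3 * card C + 2 * card V" by blast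
    have fin: "finite V" using hung_finite hang assms by blast
    obtain D where D: "almost_code (V \<union> {x, a, b}) (U - {v}) D" "C' \<subseteq> D" "card D = card C' + 2"
      using pendant3_extend[OF C'(1) fin hang.hyps(3)] C'(2) assms(4) by blast
    have "almost_code (V \<union> {x, a, b}) U D" using D(1) almost_code_mono by blast
    moreover have "3 * card D + 2 * card K = 3 * card C + 2 * card (V \<union> {x, a, b})"
      using D(3) C'(3) pendant3_card[OF fin hang.hyps(3)] by simp
    ultimately show ?case using C'(2) D(2) by blast
  qed
  then show ?thesis using that by blast
qed

section \<open>The exceptional trees for \<open>\<Delta> = 3\<close> and their cheaper faulty
  codes\<close>

definition path4 :: "'a \<Rightarrow> 'a \<Rightarrow> 'a \<Rightarrow> 'a \<Rightarrow> bool" where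
  "path4 w x y z \<longleftrightarrow> distinct [w, x, y, z] \<and> E w x \<and> E x y \<and> E y z \<and> \<not> E w y \<and> \<not> E w z \<and> \<not> E x z"

definition claw :: "'a \<Rightarrow> 'a \<Rightarrow> 'a \<Rightarrow> 'a \<Rightarrow> bool" where
  "claw c l m n \<longleftrightarrow> distinct [c, l, m, n] \<and> E c l \<and> E c m \<and> E c n \<and> \<not> E l m \<and> \<not> E l n \<and> \<not> E m n"

definition path_tree :: "'a set \<Rightarrow> 'a \<Rightarrow> 'a \<Rightarrow> 'a \<Rightarrow> 'a \<Rightarrow> bool" where
  "path_tree V w x y z \<longleftrightarrow> path4 w x y z \<and> hung {w, x, y, z} {z} V"

definition claw_tree :: "'a set \<Rightarrow> 'a \<Rightarrow> 'a \<Rightarrow> 'a \<Rightarrow> 'a \<Rightarrow> bool" where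
  "claw_tree V c l m n \<longleftrightarrow> claw c l m n \<and> hung {c, l, m, n} {l, m, n} V"

text \<open>An exceptional tree needs \<open>(2 * card V + 1) / 3\<close> code vertices; here one
  fewer is asked for. That \<open>v\<close> is coded is what \<open>star_extend\<close> requires in
  order to repair \<open>v\<close> with only two new leaves.\<close>

definition gain :: "'a set \<Rightarrow> 'a \<Rightarrow> bool" where
  "gain V v \<longleftrightarrow> (\<exists>C. almost_code V {v} C \<and> v \<in> C \<and> 3 * card C + 2 \<le> 2 * card V)"

lemma path4_rev: "path4 w x y z \<Longrightarrow> path4 z y x w"
  unfolding path4_def using E_sym by auto

lemma claw_rotate: "claw c l m n \<Longrightarrow> claw c m l n" "claw c l m n \<Longrightarrow> claw c n l m"
  unfolding claw_def using E_sym by auto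

lemma claw_tree_rotate:
  assumes "claw_tree V c l m n"
  shows "claw_tree V c m l n" "claw_tree V c n l m"
proof -
  have "{c, m, l, n} = {c, l, m, n}" "{m, l, n} = {l, m, n}" by blast+
  then show "claw_tree V c m l n" using assms claw_rotate(1) unfolding claw_tree_def by metis
  have "{c, n, l, m} = {c, l, m, n}" "{n, l, m} = {l, m, n}" by blast+
  then show "claw_tree V c n l m" using assms claw_rotate(2) unfolding claw_tree_def by metis
qed

lemma claw_tree_choose:
  assumes "claw_tree V c l m n" "t \<in> {l, m, n}"
  obtains r s where "claw_tree V c t r s" "{t, r, s} = {l, m, n}"
proof -
  consider "t = l" | "t = m" | "t = n" using assms(2) by blast
  then show ?thesis
    by cases (use assms claw_tree_rotate that in blast)+
qed

lemma path4_edges: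
  assumes "path4 w x y z"
  shows "w \<noteq> x" "w \<noteq> y" "w \<noteq> z" "x \<noteq> y" "x \<noteq> z" "y \<noteq> z" "x \<noteq> w" "y \<noteq> w" "z \<noteq> w" "y \<noteq> x" "z \<noteq> x" "z \<noteq> y"
    "E w x" "E x y" "E y z" "E x w" "E y x" "E z y"
    "\<not> E w y" "\<not> E w z" "\<not> E x z" "\<not> E y w" "\<not> E z w" "\<not> E z x"
  using assms E_sym unfolding path4_def by (simp; blast)+

lemma claw_edges:
  assumes "claw c l m n"
  shows "c \<noteq> l" "c \<noteq> m" "c \<noteq> n" "l \<noteq> m" "l \<noteq> n" "m \<noteq> n" "l \<noteq> c" "m \<noteq> c" "n \<noteq> c" "m \<noteq> l" "n \<noteq> l" "n \<noteq> m"
    "E c l" "E c m" "E c n" "E l c" "E m c" "E n c"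
    "\<not> E l m" "\<not> E l n" "\<not> E m n" "\<not> E m l" "\<not> E n l" "\<not> E n m"
  using assms E_sym unfolding claw_def by (simp; blast)+

lemma almost_code_iff: "almost_code V U C \<longleftrightarrow> C \<subseteq> V \<and> (\<forall>u\<in>V. \<exists>d\<in>C. u = d \<or> E u d) \<and>
     (\<forall>u\<in>V. \<forall>v\<in>V. u \<noteq> v \<longrightarrow> u \<notin> U \<longrightarrow> v \<notin> U \<longrightarrow> (\<exists>d\<in>C. (u = d \<or> E u d) \<noteq> (v = d \<or> E v d)))"
  unfolding almost_code_def separates_def adjeq_def by blast

text \<open>The last code is faulty at both ends: a star hung at \<open>z\<close> repairs
  \<open>z\<close> and leaves a fault at the coded end \<open>w\<close>. The third code has its
  fault at an uncoded end, so it is of use below a fork or a path, but not below a 3-star.\<close>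

lemma path4_codes:
  assumes "path4 w x y z"
  shows "almost_code {w, x, y, z} {x} {x, y}" "almost_code {w, x, y, z} {y} {x, y}"
    "almost_code {w, x, y, z} {z} {w, y}" "almost_code {w, x, y, z} {w, z} {w, z}"
  unfolding almost_code_iff using path4_edges[OF assms] by simp_all

text \<open>The only confused pair is \<open>u\<close>, \<open>a\<close>: both see exactly
  \<open>u\<close> and \<open>a\<close>. The tree has seven vertices and needs five for an
  identifying code.\<close>

lemma path4_star_code:
  assumes "path4 w x y z" "pendant3 {w, x, y, z} z u a b"
  shows "almost_code ({w, x, y, z} \<union> {u, a, b}) {a} {w, y, u, a}"
  unfolding almost_code_iff using path4_edges[OF assms(1)] pendant3_edges[OF assms(2)] by simp

text \<open>The confused pairs are \<open>x\<close>, \<open>a\<close> and \<open>c\<close>,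
  \<open>n\<close>. A further star hung at \<open>n\<close> resolves the second, so the code is
  meant for trees with stars at two different legs.\<close>

lemma claw_star_code:
  assumes "claw c l m n" "pendant3 {c, l, m, n} l x a b"
  shows "almost_code ({c, l, m, n} \<union> {x, a, b}) {a, n} {c, n, x, a}"
  unfolding almost_code_iff using claw_edges[OF assms(1)] pendant3_edges[OF assms(2)] by simp

lemma path_tree_gain_inner:
  assumes "path_tree V w x y z" "v \<in> {x, y}"
  shows "gain V v"
proof -
  have p: "path4 w x y z" "hung {w, x, y, z} {z} V" using assms by (auto simp: path_tree_def)
  have "almost_code {w, x, y, z} {v} {x, y}" using path4_codes[OF p(1)] assms(2) by auto
  then obtain C where "almost_code V {v} C" "{x, y} \<subseteq> C"
    "3 * card C + 2 * card {w, x, y, z} = 3 * card {x, y} + 2 * card V"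
    using hung_extend[OF p(2)] assms(2) by (metis finite.emptyI finite_insert empty_subsetI insert_subset insert_iff singletonI)
  moreover have "card {w, x, y, z} = 4" "card {x, y} = 2" using path4_edges[OF p(1)] by auto
  ultimately show ?thesis unfolding gain_def using assms(2) by (intro exI[of _ C]) auto
qed

lemma path_tree_gain_end:
  assumes "path_tree V w x y z" "V \<noteq> {w, x, y, z}"
  shows "gain V w"
proof -
  let ?K = "{w, x, y, z}"
  have p: "path4 w x y z" "hung ?K {z} V" using assms by (auto simp: path_tree_def)
  have c: "card ?K = 4" "card {w, z} = 2" using path4_edges[OF p(1)] by auto
  obtain W u a b where W: "V = W \<union> {u, a, b}" "hung ?K {z} W" "pendant3 W z u a b"
    using p(2) assms(2) by (cases rule: hung.cases) auto
  obtain C where C: "almost_code W {w, z} C" "{w, z} \<subseteq> C" "3 * card C + 2 * 4 = 3 * 2 + 2 * card W"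
    using hung_extend[OF W(2) _ path4_codes(4)[OF p(1)]] c by auto
  have fin: "finite W" using hung_finite[OF W(2)] by simp
  obtain D where "almost_code V ({w, z} - {z}) D" "C \<subseteq> D" "card D = card C + 2"
    using pendant3_extend[OF C(1) fin W(3)] C(2) W(1) by auto
  moreover have "{w, z} - {z} = {w}" using path4_edges[OF p(1)] by auto
  ultimately show ?thesis
    unfolding gain_def using C(2,3) pendant3_card[OF fin W(3)] W(1) by (intro exI[of _ D]) auto
qed

lemma path_tree_gain_leaf:
  assumes "path_tree W w x y z" "pendant3 W z u a b"
  shows "gain (W \<union> {u, a, b}) a"
proof -
  let ?K = "{w, x, y, z}"
  have p: "path4 w x y z" "hung ?K {z} W" using assms by (auto simp: path_tree_def)
  have "?K \<subseteq> W" using hung_subset p by blast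
  then have K: "pendant3 ?K z u a b" using assms(2) unfolding pendant3_def by blast
  have h: "hung (?K \<union> {u, a, b}) {z} (W \<union> {u, a, b})" using hung_hang_before[OF p(2) _ assms(2)] by simp
  have c: "card (?K \<union> {u, a, b}) = 7" "card {w, y, u, a} = 4"
    using pendant3_card[OF _ K] path4_edges[OF p(1)] pendant3_edges[OF K] by auto
  obtain C where "almost_code (W \<union> {u, a, b}) {a} C" "{w, y, u, a} \<subseteq> C"
      "3 * card C + 2 * 7 = 3 * 4 + 2 * card (W \<union> {u, a, b})"
    using hung_extend[OF h _ path4_star_code[OF p(1) K]] unfolding c by auto
  then show ?thesis unfolding gain_def by (intro exI[of _ C]) auto
qed

text \<open>With the star at \<open>l\<close> taken into the core, \<open>claw_star_code\<close> has
  faults at \<open>a\<close> and \<open>n\<close>. The star at \<open>n\<close> is hung last and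
  removes the fault at \<open>n\<close>.\<close>

lemma claw_tree_gain_leaf:
  assumes "claw_tree W c l m n" "pendant3 W n y d e" "pendant3 (W \<union> {y, d, e}) l x a b"
  shows "gain (W \<union> {y, d, e} \<union> {x, a, b}) a"
proof -
  let ?K = "{c, l, m, n}" and ?S = "{x, a, b}"
  have p: "claw c l m n" "hung ?K {l, m, n} W" using assms by (auto simp: claw_tree_def)
  have KW: "?K \<subseteq> W" using hung_subset p by blast
  have ex: "pendant3 W l x a b" "pendant3 (W \<union> ?S) n y d e"
    using pendant3_exchange[OF assms(2,3)] KW by auto
  then have K: "pendant3 ?K l x a b" using KW unfolding pendant3_def by blast
  have h: "hung (?K \<union> ?S) {l, m, n} (W \<union> ?S)" using hung_hang_before[OF p(2) _ ex(1)] by auto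
  have c: "card (?K \<union> ?S) = 7" "card {c, n, x, a} = 4"
    using pendant3_card[OF _ K] claw_edges[OF p(1)] pendant3_edges[OF K] by auto
  obtain C where C: "almost_code (W \<union> ?S) {a, n} C" "{c, n, x, a} \<subseteq> C"
      "3 * card C + 2 * 7 = 3 * 4 + 2 * card (W \<union> ?S)"
    using hung_extend[OF h _ claw_star_code[OF p(1) K]] unfolding c by auto
  have fin: "finite (W \<union> ?S)" using hung_finite[OF h] by simp
  obtain D where "almost_code (W \<union> ?S \<union> {y, d, e}) ({a, n} - {n}) D" "C \<subseteq> D" "card D = card C + 2"
    using pendant3_extend[OF C(1) fin ex(2)] C(2) by auto
  moreover have "{a, n} - {n} = {a}" using pendant3_edges[OF K] by auto
  moreover have "W \<union> {y, d, e} \<union> ?S = W \<union> ?S \<union> {y, d, e}" by blast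
  ultimately show ?thesis
    unfolding gain_def using C(2,3) pendant3_card[OF fin ex(2)] by (intro exI[of _ D]) auto
qed

text \<open>If stars hang at \<open>l\<close> only, then all star centres adjacent to \<open>l\<close>, among them \<open>c\<close>, play the same
  role.\<close>

lemma claw_tree_reroot:
  assumes "claw c l m n" "hung {c, l, m, n} {l} W" "pendant3 W l x a b"
  shows "claw_tree (W \<union> {x, a, b}) x l a b"
proof -
  let ?K = "{x, l, a, b}"
  have KW: "{c, l, m, n} \<subseteq> W" using hung_subset assms by blast
  have "hung ?K {l} (W \<union> {x, a, b})" using assms(2,3)
  proof (induction rule: hung.induct)
    case core
    have "pendant3 ?K l c m n"
      using claw_edges[OF assms(1)] pendant3_edges[OF core] unfolding pendant3_def by simp
    then have "hung ?K {l} (?K \<union> {c, m, n})" by (intro hung.hang hung.core) auto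
    moreover have "?K \<union> {c, m, n} = {c, l, m, n} \<union> {x, a, b}" by blast
    ultimately show ?case by simp
  next
    case (hang V v y d e)
    have "v \<in> V" "l \<in> V" using hang hung_subset by blast+
    then have ex: "pendant3 V l x a b" "pendant3 (V \<union> {x, a, b}) v y d e"
      using pendant3_exchange[OF hang.hyps(3) hang.prems] by auto
    then have "hung ?K {l} (V \<union> {x, a, b} \<union> {y, d, e})"
      using hang.IH[OF ex(1)] hang.hyps(2) hung.hang by blast
    then show ?case by (simp add: Un_ac)
  qed
  moreover have "claw x l a b"
    using pendant3_edges[OF assms(3)] KW unfolding claw_def by auto
  ultimately show ?thesis unfolding claw_tree_def by (auto intro: hung_mono)
qed

text \<open>No degree bound is built in: arbitrarily many stars may hang at one vertex, and the
  bound enters through separate hypotheses where it is used.\<close>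

definition exceptional3 :: "'a set \<Rightarrow> bool" where
  "exceptional3 V \<longleftrightarrow> (\<exists>v. V = {v}) \<or> (\<exists>w x y z. path_tree V w x y z) \<or> (\<exists>c l m n. claw_tree V c l m n)"

section \<open>Attaching a 3-star to an exceptional tree\<close>

lemma degree_4:
  assumes "finite V" "{p, q, r, s} \<subseteq> V" "distinct [p, q, r, s]" "E u p" "E u q" "E u r" "E u s"
  shows "\<not> card (nbrs V u) \<le> 3"
proof -
  have "card {p, q, r, s} \<le> card (nbrs V u)"
    using assms by (intro card_mono) (auto simp: nbrs_def)
  then show ?thesis using assms(3) by simp
qed

lemma pendant3_centre_full:
  assumes "finite W" "pendant3 W v x a b" "W \<union> {x, a, b} \<subseteq> V" "finite V" "s \<in> V" "s \<notin> W \<union> {x, a, b}" "E x s"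
  shows "\<not> card (nbrs V x) \<le> 3"
  using assms by (intro degree_4[of V v a b s]) (auto simp: pendant3_def)

lemma claw_centre_full:
  assumes "claw c l m n" "{c, l, m, n} \<subseteq> W" "W \<subseteq> V" "finite V" "s \<in> V" "s \<notin> W" "E c s"
  shows "\<not> card (nbrs V c) \<le> 3"
  using assms by (intro degree_4[of V l m n s]) (auto simp: claw_def)

text \<open>A normal form up to symmetry: the legs are interchangeable, so are the two new leaves of
  a star, and the star through \<open>v\<close> can be made the last one.\<close>

lemma claw_tree_star_leaf:
  assumes "claw_tree V c l m n" "v \<in> V - {c, l, m, n}"
  obtains W t r s x a b where "V = W \<union> {x, a, b}" "claw_tree W c t r s" "pendant3 W t x a b" "{t, r, s} = {l, m, n}" "v \<in> {x, a}"
proof -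
  have cl: "claw c l m n" "hung {c, l, m, n} {l, m, n} V" using assms by (auto simp: claw_tree_def)
  obtain W t x a b where W: "V = W \<union> {x, a, b}" "hung {c, l, m, n} {l, m, n} W" "t \<in> {l, m, n}"
    "pendant3 W t x a b" "v \<in> {x, a, b}"
    by (rule hung_pull[OF cl(2) _ assms(2)]) blast
  have "claw_tree W c l m n" using W cl by (simp add: claw_tree_def)
  then obtain r s where rs: "claw_tree W c t r s" "{t, r, s} = {l, m, n}" using claw_tree_choose W by metis
  show ?thesis
  proof (cases "v = b")
    case True
    then show ?thesis using that[of W x b a] W rs pendant3_swap by (auto simp: insert_commute)
  next
    case False
    then show ?thesis using that W rs by blast
  qed
qed

text \<open>The root and the star centres are saturated by the degree bound, so \<open>v\<close> is
  a leg or a leaf of a star at some leg \<open>t\<close>. If all other stars hang at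
  \<open>t\<close> too, moving the root to the star centre next to \<open>v\<close> turns
  \<open>v\<close> into a leg. The case \<open>far\<close> serves twice: it yields a cheaper code
  for the upper bound, and a path too long for diameter 6.\<close>

lemma claw_tree_attach:
  assumes claw: "claw_tree V c l m n" and fin: "finite V" and p: "pendant3 V v x a b"
    and deg: "\<forall>u\<in>V \<union> {x, a, b}. card (nbrs (V \<union> {x, a, b}) u) \<le> 3"
  obtains (claw_tree) c l m n where "claw_tree (V \<union> {x, a, b}) c l m n"
  | (far) W t r s y f g u e where "V = W \<union> {y, f, g} \<union> {u, v, e}" "claw_tree W c t r s"
      "pendant3 W s y f g" "pendant3 (W \<union> {y, f, g}) t u v e"
proof -
  let ?V = "V \<union> {x, a, b}" and ?K = "{c, l, m, n}"
  have vV: "v \<in> V" using p by (simp add: pendant3_def)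
  have xV: "x \<notin> V" "E v x" "x \<in> ?V" using pendant3_edges[OF p] p by (auto simp: pendant3_def)
  have q: "claw c l m n" "hung ?K {l, m, n} V" using claw by (auto simp: claw_tree_def)
  have "v \<noteq> c" using claw_centre_full[OF q(1), of V ?V x] hung_subset[OF q(2)] deg fin xV by auto
  show ?thesis
  proof (cases "v \<in> ?K")
    case True
    then have "claw_tree ?V c l m n" using \<open>v \<noteq> c\<close> q(1) hung.hang[OF q(2) _ p] unfolding claw_tree_def by blast
    then show ?thesis using claw_tree by blast
  next
    case False
    then have vK: "v \<in> V - ?K" using vV by blast
    obtain W t r s u d e where W: "V = W \<union> {u, d, e}" "claw_tree W c t r s" "pendant3 W t u d e" "v \<in> {u, d}"
      by (rule claw_tree_star_leaf[OF claw vK])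
    have "v \<noteq> u" using pendant3_centre_full[OF _ W(3), of ?V x] deg fin W(1) xV by auto
    then have v: "v = d" using W by blast
    have h: "claw c t r s" "hung {c, t, r, s} {t, r, s} W" using W(2) by (auto simp: claw_tree_def)
    show ?thesis
    proof (cases "hung {c, t, r, s} {t} W")
      case True
      have "claw_tree V u t d e" using claw_tree_reroot[OF h(1) True W(3)] W(1) by simp
      then have "claw_tree ?V u t d e" using v p hung.hang[of "{u, t, d, e}" "{t, d, e}" V v x a b]
        unfolding claw_tree_def by blast
      then show ?thesis using claw_tree by blast
    next
      case no: False
      obtain W' t' y f g where W': "W = W' \<union> {y, f, g}" "hung {c, t, r, s} {t, r, s} W'" "t' \<in> {t, r, s}" "t' \<noteq> t" "pendant3 W' t' y f g"
        by (rule hung_pull_other[OF h(2) _ _ no]) blast+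
      have "claw_tree W' c t r s" using W' h(1) by (simp add: claw_tree_def)
      then obtain r' where "claw_tree W' c t r' t'"
        using W'(3,4) claw_tree_rotate by (metis insertE singletonD)
      then show ?thesis using far[of W' y f g u e t r' t'] W' W(1,3) v by simp
    qed
  qed
qed

lemma exceptional3_attach:
  assumes ex: "exceptional3 V" and fin: "finite V" and p: "pendant3 V v x a b"
    and deg: "\<And>u. u \<in> V \<union> {x, a, b} \<Longrightarrow> card (nbrs (V \<union> {x, a, b}) u) \<le> 3"
  shows "exceptional3 (V \<union> {x, a, b}) \<or> gain V v"
proof -
  let ?V = "V \<union> {x, a, b}"
  have vV: "v \<in> V" using p by (simp add: pendant3_def)
  have xV: "x \<notin> V" "E v x" "x \<in> ?V" using pendant3_edges[OF p] p by (auto simp: pendant3_def)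
  consider (single) "V = {v}" | (path) w s y z where "path_tree V w s y z"
    | (claw) c l m n where "claw_tree V c l m n"
    using ex vV unfolding exceptional3_def by blast
  then show ?thesis
  proof cases
    case single
    have "claw x v a b" using pendant3_edges[OF p] vV unfolding claw_def by auto
    then have "claw_tree {x, v, a, b} x v a b" by (simp add: claw_tree_def hung.core)
    moreover have "?V = {x, v, a, b}" using single by blast
    ultimately show ?thesis unfolding exceptional3_def by metis
  next
    case path
    let ?K = "{w, s, y, z}"
    have q: "path4 w s y z" "hung ?K {z} V" using path by (auto simp: path_tree_def)
    show ?thesis
    proof (cases "v \<in> ?K")
      case True
      then consider "v = z" | "v = w" "V = ?K" | "v = w" "V \<noteq> ?K" | "v \<in> {s, y}" by blast
      then show ?thesis
      proof cases
        case 1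
        then have "path_tree ?V w s y z" using q(1) hung.hang[OF q(2) _ p] unfolding path_tree_def by blast
        then show ?thesis unfolding exceptional3_def by blast
      next
        case 2
        \<comment> \<open>A bare path has no distinguished end; reversing it makes \<open>w\<close>
          the end that carries the stars.\<close>
        then have "hung {z, y, s, w} {w} V" using hung.core by (metis insert_commute)
        then have "hung {z, y, s, w} {w} ?V" using hung.hang[of "{z, y, s, w}" "{w}" V v x a b] p 2 by simp
        then have "path_tree ?V z y s w" using path4_rev[OF q(1)] unfolding path_tree_def by blast
        then show ?thesis unfolding exceptional3_def by blast
      next
        case 3
        then show ?thesis using path_tree_gain_end[OF path] by simp
      next
        case 4
        then show ?thesis using path_tree_gain_inner[OF path] by simp
      qed
    next
      case False
      obtain W t u d e where W: "V = W \<union> {u, d, e}" "hung ?K {z} W" "t \<in> {z}" "pendant3 W t u d e" "v \<in> {u, d, e}"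
        by (rule hung_pull[OF q(2), of v]) (use False vV in blast)+
      have pt: "path_tree W w s y z" using W q by (simp add: path_tree_def)
      have "v \<noteq> u"
        using pendant3_centre_full[OF _ W(4), of ?V x] deg fin W(1) xV by auto
      then consider "v = d" | "v = e" using W(5) by blast
      then show ?thesis
      proof cases
        case 1
        then show ?thesis using path_tree_gain_leaf[OF pt] W by simp
      next
        case 2
        then have "gain (W \<union> {u, e, d}) v" using path_tree_gain_leaf[OF pt, of u e d] pendant3_swap W(3,4) by simp
        moreover have "V = W \<union> {u, e, d}" using W(1) by blast
        ultimately show ?thesis by simp
      qed
    qed
  next
    case claw
    have "\<forall>u\<in>?V. card (nbrs ?V u) \<le> 3" using deg by blast
    from claw fin p this show ?thesis
    proof (cases rule: claw_tree_attach)
      case claw_tree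
      then show ?thesis unfolding exceptional3_def by blast
    next
      case (far W t r s y f g u e)
      then show ?thesis using claw_tree_gain_leaf[OF far(2,3,4)] by simp
    qed
  qed
qed

end

section \<open>The upper bound\<close>

context sgraph begin

text \<open>The rest of the tree touches \<open>W\<close> and the star at \<open>v\<close> only, so
  a star avoiding \<open>v\<close> looks the same in \<open>V\<close>. In a tree without end stars
  this forces the attachment vertex onto every star that can be hung last.\<close>

lemma pendant3_end_star:
  assumes p: "pendant3 W t u d e" and sub: "W \<union> {u, d, e} \<subseteq> V" and fin: "finite V"
    and out: "\<And>s r. s \<in> V - (W \<union> {u, d, e}) \<Longrightarrow> r \<in> W \<union> {u, d, e} \<Longrightarrow> E s r \<Longrightarrow> r = v"
    and v: "v \<notin> {u, d, e}"
  shows "end_star V u t"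
proof -
  note pe = pendant3_edges[OF p]
  have tW: "t \<in> W" using p by (simp add: pendant3_def)
  have no: "\<not> E r s" if "r \<in> {u, d, e}" "s \<in> V - (W \<union> {u, d, e})" for r s
    using out[of s r] that v E_sym by blast
  have Nu: "nbrs V u = {t, d, e}"
  proof -
    have "s \<in> {t, d, e}" if "s \<in> V" "E u s" for s
    proof (cases "s \<in> W")
      case False
      then show ?thesis using no[of u s] that E_irrefl by blast
    qed (use pe that in auto)
    then show ?thesis using tW sub pe by (auto simp: nbrs_def)
  qed
  have leaf: "nbrs V r = {u}" if r: "r \<in> {d, e}" for r
  proof -
    have "s = u" if "s \<in> V" "E r s" for s
    proof (cases "s \<in> W")
      case True
      then show ?thesis using pe that r by auto
    next
      case False
      then show ?thesis using no[of r s] that E_irrefl r pe by blast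
    qed
    moreover have "E r u" "u \<in> V" using r pe sub by auto
    ultimately show ?thesis unfolding nbrs_def by blast
  qed
  have "card {t, d, e} = 3" using pe tW by auto
  then show ?thesis unfolding end_star_def Nu using leaf sub tW pe by auto
qed

lemma hung_core_nbrs: "hung K Z V \<Longrightarrow> Z \<subseteq> K \<Longrightarrow> k \<in> K - Z \<Longrightarrow> u \<in> V - K \<Longrightarrow> \<not> E k u"
proof (induction rule: hung.induct)
  case (hang V v x a b)
  have "k \<in> V" "k \<noteq> v" using hang hung_subset[OF hang.hyps(1)] by auto
  then show ?case using hang pendant3_edges(22,25,26)[OF hang.hyps(3)] by auto
qed simp

text \<open>Whether \<open>v\<close> is coded is left open because \<open>path_extend\<close> and
  \<open>fork_extend\<close> repair \<open>v\<close> in either case.\<close>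

definition weak_gain :: "'a set \<Rightarrow> 'a \<Rightarrow> bool" where
  "weak_gain V v \<longleftrightarrow> (\<exists>C. almost_code V {v} C \<and> 3 * card C + 2 \<le> 2 * card V)"

lemma gain_weak: "gain V v \<Longrightarrow> weak_gain V v"
  unfolding gain_def weak_gain_def by blast

lemma path4_weak_gain:
  assumes "path4 w x y z" "v \<in> {w, x, y, z}"
  shows "weak_gain {w, x, y, z} v"
proof -
  have c: "card {w, x, y, z} = 4" "card {x, y} = 2" "card {w, y} = 2" "card {z, x} = 2"
    using path4_edges[OF assms(1)] by auto
  have "almost_code {w, x, y, z} {w} {z, x}"
    using path4_codes(3)[OF path4_rev[OF assms(1)]] by (simp add: insert_commute)
  then have "\<exists>C. almost_code {w, x, y, z} {v} C \<and> card C = 2"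
    using path4_codes(1-3)[OF assms(1)] assms(2) c by blast
  then show ?thesis unfolding weak_gain_def c(1) by auto
qed

text \<open>A hung star must contain \<open>v\<close>, or it would be an end star of
  \<open>W\<close>; its centre is saturated, so \<open>v\<close> is one of its leaves. For path
  trees the faulty codes at such leaves apply. Claw trees cannot occur: either a star avoids
  \<open>v\<close>, or the core claw has at most one leg leading further and is itself an end
  star.\<close>

lemma exceptional3_weak_gain:
  assumes ex: "exceptional3 V" and fin: "finite W" and VW: "V \<subseteq> W" and vV: "v \<in> V"
    and out: "\<And>s r. s \<in> W - V \<Longrightarrow> r \<in> V \<Longrightarrow> E s r \<Longrightarrow> r = v"
    and s: "s \<in> W - V" "E v s"
    and deg: "\<And>u. u \<in> W \<Longrightarrow> card (nbrs W u) \<le> 3"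
    and no: "\<And>x y. \<not> end_star W x y"
  shows "V = {v} \<or> weak_gain V v"
proof -
  have finV: "finite V" using VW fin finite_subset by blast
  have centre: "v \<noteq> u" if "V = X \<union> {u, d, e}" "pendant3 X t u d e" for X t u d e
    using pendant3_centre_full[OF _ that(2), of W s] that fin finV deg[of u] VW vV s by auto
  have leaf: "v \<in> {d, e}" if "V = X \<union> {u, d, e}" "pendant3 X t u d e" for X t u d e
    using pendant3_end_star[OF that(2), of W v] that(1) VW fin out no centre[OF that] by blast
  consider (single) "V = {v}" | (path) w x y z where "path_tree V w x y z"
    | (claw) c l m n where "claw_tree V c l m n"
    using ex vV unfolding exceptional3_def by blast
  then show ?thesis
  proof cases
    case path
    let ?K = "{w, x, y, z}"
    have q: "path4 w x y z" "hung ?K {z} V" using path by (auto simp: path_tree_def)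
    show ?thesis
    proof (cases "V = ?K")
      case True
      then show ?thesis using path4_weak_gain[OF q(1)] vV by simp
    next
      case False
      obtain X u d e where X: "V = X \<union> {u, d, e}" "hung ?K {z} X" "pendant3 X z u d e"
        using q(2) False by (cases rule: hung.cases) auto
      have pt: "path_tree X w x y z" using X q by (simp add: path_tree_def)
      have "gain (X \<union> {u, d, e}) d" "gain (X \<union> {u, e, d}) e"
        using path_tree_gain_leaf[OF pt] X(3) pendant3_swap by blast+
      moreover have "X \<union> {u, e, d} = V" using X(1) by blast
      ultimately show ?thesis using leaf[OF X(1,3)] X(1) gain_weak by auto
    qed
  next
    case claw
    let ?K = "{c, l, m, n}"
    have q: "claw c l m n" "hung ?K {l, m, n} V" using claw by (auto simp: claw_tree_def)
    have KV: "?K \<subseteq> V" using hung_subset q by blast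
    have "v \<noteq> c" using claw_centre_full[OF q(1) KV VW fin, of s] deg[of c] KV VW s by auto
    have claw_end: False
      if "claw c t r r'" "{c, t, r, r'} \<subseteq> V" "v \<notin> {c, r, r'}"
        "\<And>u. u \<in> V \<Longrightarrow> E c u \<Longrightarrow> u \<in> {t, r, r'}" "\<And>u. u \<in> V \<Longrightarrow> E r u \<Longrightarrow> u = c" "\<And>u. u \<in> V \<Longrightarrow> E r' u \<Longrightarrow> u = c"
      for t r r'
    proof -
      note ce = claw_edges[OF that(1)]
      have out': "u \<in> V" if "u \<in> W" "E k u" "k \<in> {c, r, r'}" for k u
        using out[of u k] that \<open>{c, t, r, r'} \<subseteq> V\<close> \<open>v \<notin> {c, r, r'}\<close> E_sym by blast
      have "nbrs W c = {t, r, r'}" using that(2,4) out' VW ce by (auto simp: nbrs_def)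
      moreover have "nbrs W r = {c}" "nbrs W r' = {c}" using that(2,5,6) out' VW ce unfolding nbrs_def by blast+
      moreover have "card {t, r, r'} = 3" using ce by auto
      ultimately have "end_star W c t" unfolding end_star_def using that(2) VW ce by auto
      then show False using no by blast
    qed
    show ?thesis
    proof (cases "v \<in> ?K")
      case True
      then have "v \<in> {l, m, n}" using \<open>v \<noteq> c\<close> by blast
      then obtain r r' where "claw_tree V c v r r'" by (rule claw_tree_choose[OF claw])
      then have rr: "claw c v r r'" "hung {c, v, r, r'} {v, r, r'} V" by (auto simp: claw_tree_def)
      show ?thesis
      proof (cases "V = {c, v, r, r'}")
        case True
        have False by (rule claw_end[OF rr(1)]) (use True claw_edges[OF rr(1)] E_irrefl in auto)
        then show ?thesis ..
      next
        case False
        obtain X t u d e where X: "V = X \<union> {u, d, e}" "hung {c, v, r, r'} {v, r, r'} X" "pendant3 X t u d e"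
          using rr(2) False by (cases rule: hung.cases) auto
        have "v \<in> X" using hung_subset[OF X(2)] by blast
        then show ?thesis using leaf[OF X(1,3)] X(3) unfolding pendant3_def by auto
      qed
    next
      case False
      then have vK: "v \<in> V - ?K" using vV by blast
      obtain X t r r' u d e where X: "V = X \<union> {u, d, e}" "claw_tree X c t r r'" "pendant3 X t u d e" "v \<in> {u, d}"
        by (rule claw_tree_star_leaf[OF claw vK])
      have v: "v = d" using centre[OF X(1,3)] X(4) by blast
      have h: "claw c t r r'" "hung {c, t, r, r'} {t, r, r'} X" using X(2) by (auto simp: claw_tree_def)
      note ce = claw_edges[OF h(1)] and pe = pendant3_edges[OF X(3)]
      have KX: "{c, t, r, r'} \<subseteq> X" using hung_subset[OF h(2)] .
      have False
      proof (cases "hung {c, t, r, r'} {t} X")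
        case True
        have far: "u' \<in> {c, t, r, r'}" if "u' \<in> V" "E k u'" "k \<in> {c, r, r'}" for k u'
        proof -
          have "k \<in> X" "k \<noteq> t" using that KX ce by auto
          then have "u' \<in> X" using that X(1) pe(22,25,26) by auto
          then show ?thesis using hung_core_nbrs[OF True, of k u'] that \<open>k \<noteq> t\<close> by auto
        qed
        show False
        proof (rule claw_end[OF h(1)])
          show "u' \<in> {t, r, r'}" if "u' \<in> V" "E c u'" for u' using far[OF that] that E_irrefl by blast
          show "u' = c" if "u' \<in> V" "E r u'" for u' using far[OF that] that E_irrefl ce by blast
          show "u' = c" if "u' \<in> V" "E r' u'" for u' using far[OF that] that E_irrefl ce by blast
        qed (use KX X(1) v pe in auto)
      next
        case no: False
        \<comment> \<open>A star at a leg other than \<open>t\<close> can be made the last one, so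
          \<open>v\<close> would have to be a leaf of it as well as of the star at
          \<open>t\<close>.\<close>
        obtain X' t' y f g where X': "X = X' \<union> {y, f, g}" "hung {c, t, r, r'} {t, r, r'} X'"
          "t' \<in> {t, r, r'}" "t' \<noteq> t" "pendant3 X' t' y f g"
          by (rule hung_pull_other[OF h(2) _ _ no]) blast+
        have "t \<in> X'" using hung_subset[OF X'(2)] by blast
        then have "pendant3 (X' \<union> {u, d, e}) t' y f g"
          using pendant3_exchange(2)[OF X'(5), of t u d e] X(3) X'(1) by simp
        moreover have "V = X' \<union> {u, d, e} \<union> {y, f, g}" using X(1) X'(1) by blast
        ultimately have "v \<in> {f, g}" using leaf by blast
        then show False using v X(3) X'(1) unfolding pendant3_def by blast
      qed
      then show ?thesis ..
    qed
  qed simp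
qed

text \<open>The bound \<open>card C \<le> ((\<Delta> - 1) * card V + e) / \<Delta>\<close> cleared
  of division and subtraction; the two values in the theorem are \<open>e = 1\<close> and
  \<open>e = 0\<close>.\<close>

definition bounded_code :: "nat \<Rightarrow> 'a set \<Rightarrow> nat \<Rightarrow> bool" where
  "bounded_code \<Delta> V e \<longleftrightarrow> (\<exists>C. almost_code V {} C \<and> \<Delta> * card C + card V \<le> \<Delta> * card V + e)"

definition big_star :: "nat \<Rightarrow> 'a set \<Rightarrow> bool" where
  "big_star \<Delta> V \<longleftrightarrow> (\<exists>c\<in>V. V = insert c (nbrs V c) \<and> card (nbrs V c) = \<Delta> \<and> (\<forall>u\<in>nbrs V c. nbrs V u = {c}))"

text \<open>The single vertex is included for every \<Delta>: its only code attains the bound with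
  \<open>e = 1\<close>.\<close>

definition exceptional :: "nat \<Rightarrow> 'a set \<Rightarrow> bool" where
  "exceptional \<Delta> V \<longleftrightarrow> (\<exists>v. V = {v}) \<or> \<Delta> = 3 \<and> exceptional3 V \<or> 4 \<le> \<Delta> \<and> big_star \<Delta> V"

lemma bounded_code_mono: "bounded_code \<Delta> V e \<Longrightarrow> e \<le> e' \<Longrightarrow> bounded_code \<Delta> V e'"
  unfolding bounded_code_def by fastforce

section \<open>Attaching configurations within the bounds, and the induction\<close>

lemma pair_code:
  assumes "subtree V" "card V = 2" "v \<in> V"
  shows "almost_code V {v} {v}"
proof -
  obtain p where p: "V = {v, p}" "p \<noteq> v"
    using assms(2,3) by (auto simp: card_2_iff)
  have "E v p"
  proof (rule ccontr)
    assume "\<not> E v p"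
    then have "{v} = V" using p E_irrefl by (intro subtree_closed[OF assms(1)]) auto
    then show False using p by auto
  qed
  then show ?thesis using p E_sym unfolding almost_code_iff by auto
qed

text \<open>The code of the old star omits two leaves, \<open>a\<close> and the attachment leaf
  \<open>v\<close>, which are confused only with each other. As the new star has
  \<open>\<Delta> - 1 \<ge> 3\<close> new leaves, it repairs \<open>v\<close> although
  \<open>v\<close> is uncoded, and it omits one more vertex. Three omitted among
  \<open>2 * \<Delta> + 1\<close> vertices is just what the bound with \<open>e = 0\<close>
  demands.\<close>

lemma big_star_attach:
  assumes bs: "big_star \<Delta> V" and d4: "4 \<le> \<Delta>" and fin: "finite V" and vV: "v \<in> V"
    and A: "finite A" "card A + 1 = \<Delta>" "x \<notin> V" "x \<notin> A" "A \<inter> V = {}"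
    and xv: "\<And>u. u \<in> V \<Longrightarrow> E x u \<longleftrightarrow> u = v"
    and xa: "\<And>a. a \<in> A \<Longrightarrow> E x a"
    and aa: "\<And>a u. a \<in> A \<Longrightarrow> u \<in> V \<union> A \<Longrightarrow> \<not> E a u"
    and deg: "card (nbrs (V \<union> insert x A) v) \<le> \<Delta>"
  shows "bounded_code \<Delta> (V \<union> insert x A) 0"
proof -
  obtain c where c: "c \<in> V" "V = insert c (nbrs V c)" "card (nbrs V c) = \<Delta>" "\<And>u. u \<in> nbrs V c \<Longrightarrow> nbrs V u = {c}"
    using bs unfolding big_star_def by blast
  let ?L = "nbrs V c"
  have finL: "finite ?L" and cL: "c \<notin> ?L" using fin E_irrefl by (auto simp: nbrs_def)
  have "v \<noteq> c"
  proof
    assume "v = c"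
    have "E v x" using xv[OF vV] E_sym by blast
    then have sub: "insert x ?L \<subseteq> nbrs (V \<union> insert x A) v" unfolding nbrs_def \<open>v = c\<close> by blast
    have "finite (nbrs (V \<union> insert x A) v)" using fin A(1) by (simp add: nbrs_def)
    then have "card (insert x ?L) \<le> \<Delta>" using le_trans[OF card_mono[OF _ sub] deg] by simp
    moreover have "x \<notin> ?L" using A(3) by (simp add: nbrs_def)
    ultimately show False using finL c(3) by simp
  qed
  then have vL: "v \<in> ?L" using vV c(2) by blast
  have adj: "E u t \<longleftrightarrow> (u = c \<and> t \<in> ?L) \<or> (t = c \<and> u \<in> ?L)" if "u \<in> V" "t \<in> V" for u t
  proof (cases "u = c")
    case True
    then show ?thesis using that cL by (auto simp: nbrs_def)
  next
    case False
    then have "nbrs V u = {c}" using c(2,4) that by blast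
    then have "E u t \<longleftrightarrow> t = c" using that by (auto simp: nbrs_def)
    then show ?thesis using False c(2) that by blast
  qed
  have third: "\<exists>t\<in>?L. t \<notin> {p, q, r}" for p q r
  proof (rule ccontr)
    assume "\<not> ?thesis"
    then have "?L \<subseteq> {p, q, r}" by blast
    then have "card ?L \<le> card {p, q, r}" by (intro card_mono) auto
    also have "\<dots> \<le> 3" by (simp add: card_insert_if)
    finally show False using c(3) d4 by simp
  qed
  obtain a where a: "a \<in> ?L" "a \<noteq> v" using third[of v v v] by auto
  let ?C = "V - {a, v}"
  have LV: "?L \<subseteq> V" by (auto simp: nbrs_def)
  have "almost_code V {v} ?C"
    unfolding almost_code_iff
  proof (intro conjI ballI impI)
    fix u assume u: "u \<in> V"
    have "u = c \<or> E u c" using c(2) u adj[OF u c(1)] by blast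
    moreover have "c \<in> ?C" using c(1) cL a vL by auto
    ultimately show "\<exists>d\<in>?C. u = d \<or> E u d" by blast
    fix t assume t: "t \<in> V" "u \<noteq> t" "u \<notin> {v}" "t \<notin> {v}"
    show "\<exists>d\<in>?C. (u = d \<or> E u d) \<noteq> (t = d \<or> E t d)"
    proof (cases "u = c \<or> t = c")
      case True
      \<comment> \<open>A leaf other than \<open>a\<close>, \<open>v\<close> and the second vertex
        of the pair: this is where \<open>\<Delta> \<ge> 4\<close> is used to tell \<open>c\<close>
        from a leaf.\<close>
      obtain b where "b \<in> ?L" "b \<notin> {a, v, if u = c then t else u}" using third by blast
      then show ?thesis using True t u adj cL LV by (intro bexI[of _ b]) (auto split: if_splits)
    next
      case False
      then have "u \<in> ?L" "t \<in> ?L" using u t c(2) by auto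
      then have n: "\<not> E u t" "\<not> E t u" using False adj u t(1) by blast+
      show ?thesis
      proof (cases "u = a")
        case True
        then have "t \<in> ?C" using t by blast
        then show ?thesis using n t(2) by (intro bexI[of _ t]) simp_all
      next
        case False
        then have "u \<in> ?C" using t u by blast
        then show ?thesis using n t(2) by (intro bexI[of _ u]) simp_all
      qed
    qed
  qed auto
  then obtain C' where C': "almost_code (V \<union> insert x A) ({v} - {v}) C'" "card C' = card ?C + card A"
    by (rule star_extend[OF _ fin vV A(1) _ A(3-5) xv xa aa]) (use A(2) d4 in auto)
  have "card V = \<Delta> + 1" using c(2,3) finL cL by (metis card_insert_disjoint Suc_eq_plus1)
  moreover have "card ?C = card V - 2" using a vL LV fin by (subst card_Diff_subset) auto
  moreover have "card (V \<union> insert x A) = card V + \<Delta>"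
    using fin A by (subst card_Un_disjoint) auto
  ultimately have "\<Delta> * card C' + card (V \<union> insert x A) \<le> \<Delta> * card (V \<union> insert x A) + 0"
    using C'(2) A(2) d4 by (cases \<Delta>) (auto simp: algebra_simps)
  then show ?thesis using C'(1) unfolding bounded_code_def by auto
qed

text \<open>A tree on two vertices has no identifying code, but either vertex dominates it, and the one unseparated
  pair becomes separated as soon as a configuration is attached.\<close>

definition settled :: "nat \<Rightarrow> 'a set \<Rightarrow> bool" where
  "settled \<Delta> V \<longleftrightarrow> bounded_code \<Delta> V 0 \<or> exceptional \<Delta> V \<and> bounded_code \<Delta> V 1 \<or> card V = 2"

text \<open>Two code vertices for three vertices leave \<open>\<Delta> - 3\<close> to spare. For
  \<open>\<Delta> \<ge> 4\<close> this absorbs the excess 1 of an exceptional tree; for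
  \<open>\<Delta> = 3\<close> nothing is spare, and a faulty code must supply it unless the tree was
  a single vertex, in which case the result is exceptional again.\<close>

lemma extend_by_three:
  assumes "settled \<Delta> V" "subtree V" "3 \<le> \<Delta>" "v \<in> V" "card W = card V + 3"
    and ext: "\<And>U C. almost_code V U C \<Longrightarrow> \<exists>C'. almost_code W (U - {v}) C' \<and> card C' = card C + 2"
    and single: "V = {v} \<Longrightarrow> exceptional3 W"
    and wg: "\<Delta> = 3 \<Longrightarrow> exceptional3 V \<Longrightarrow> V = {v} \<or> weak_gain V v"
  shows "bounded_code \<Delta> W 0 \<or> exceptional \<Delta> W \<and> bounded_code \<Delta> W 1"
proof -
  have ext0: "bounded_code \<Delta> W e" if "almost_code V {} C" "\<Delta> * card C + card V + 3 \<le> \<Delta> * card V + \<Delta> + e" for C e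
    using ext[OF that(1)] that(2) assms(5) unfolding bounded_code_def by (auto simp: algebra_simps)
  have ext1: "bounded_code \<Delta> W e" if "almost_code V {v} C" "\<Delta> * card C + card V + 3 \<le> \<Delta> * card V + \<Delta> + e" for C e
    using ext[OF that(1)] that(2) assms(5) unfolding bounded_code_def by (auto simp: algebra_simps)
  consider "bounded_code \<Delta> V 0" | "exceptional \<Delta> V" "bounded_code \<Delta> V 1" | "card V = 2"
    using assms(1) unfolding settled_def by blast
  then show ?thesis
  proof cases
    case 1
    then obtain C where "almost_code V {} C" "\<Delta> * card C + card V \<le> \<Delta> * card V"
      unfolding bounded_code_def by auto
    then show ?thesis using ext0[of C 0] assms(3) by simp
  next
    case 2
    then obtain C where C: "almost_code V {} C" "\<Delta> * card C + card V \<le> \<Delta> * card V + 1"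
      unfolding bounded_code_def by auto
    show ?thesis
    proof (cases "\<Delta> = 3")
      case False
      then show ?thesis using ext0[of C 0] C assms(3) by simp
    next
      case True
      then have ex: "exceptional3 V" using 2 unfolding exceptional_def exceptional3_def by auto
      show ?thesis
      proof (cases "V = {v}")
        case True
        have "bounded_code \<Delta> W 1" using ext0[of C 1] C assms(3) by simp
        then show ?thesis using single[OF True] \<open>\<Delta> = 3\<close> unfolding exceptional_def by blast
      next
        case False
        then obtain C where "almost_code V {v} C" "3 * card C + 2 \<le> 2 * card V"
          using wg[OF True ex] unfolding weak_gain_def by blast
        then show ?thesis using ext1[of C 0] True by simp
      qed
    qed
  next
    case 3
    then show ?thesis using ext1[OF pair_code[OF assms(2) 3 assms(4)], of 0] assms(3) by simp
  qed
qed

text \<open>The new star has \<open>card A + 1\<close> new vertices and omits one of them. If that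
  number is below \<Delta>, the spare amount absorbs the excess 1; only at equality does it matter
  which exceptional tree is being extended.\<close>

lemma star_attach_settled:
  assumes st: "settled \<Delta> V" "subtree V" "3 \<le> \<Delta>" and vV: "v \<in> V"
    and A: "finite A" "2 \<le> card A" "x \<notin> V" "x \<notin> A" "A \<inter> V = {}" and A\<Delta>: "card A + 1 \<le> \<Delta>"
    and xv: "\<And>u. u \<in> V \<Longrightarrow> E x u \<longleftrightarrow> u = v"
    and xa: "\<And>a. a \<in> A \<Longrightarrow> E x a"
    and aa: "\<And>a u. a \<in> A \<Longrightarrow> u \<in> V \<union> A \<Longrightarrow> \<not> E a u"
    and deg: "\<And>u. u \<in> V \<union> insert x A \<Longrightarrow> card (nbrs (V \<union> insert x A) u) \<le> \<Delta>"
  shows "bounded_code \<Delta> (V \<union> insert x A) 0 \<or>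
    exceptional \<Delta> (V \<union> insert x A) \<and> bounded_code \<Delta> (V \<union> insert x A) 1"
proof -
  let ?W = "V \<union> insert x A"
  have fin: "finite V" using st by (simp add: subtree_def)
  have cW: "card ?W = card V + card A + 1" using fin A by (subst card_Un_disjoint) auto
  have ext: "bounded_code \<Delta> ?W e"
    if al: "almost_code V U C" "U \<subseteq> {v}" "v \<in> C \<or> v \<notin> U"
      "\<Delta> * card C + card V + card A + 1 \<le> \<Delta> * card V + \<Delta> + e" for U C e
  proof -
    obtain C' where C': "almost_code ?W (U - {v}) C'" "card C' = card C + card A"
      by (rule star_extend[OF al(1) fin vV A xv xa aa]) (use al(3) in auto)
    moreover have "U - {v} = {}" using al(2) by blast
    ultimately show ?thesis using al(4) cW unfolding bounded_code_def
      by (intro exI[of _ C']) (auto simp: algebra_simps)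
  qed
  consider "bounded_code \<Delta> V 0" | "exceptional \<Delta> V" "bounded_code \<Delta> V 1" | "card V = 2"
    using st(1) unfolding settled_def by blast
  then show ?thesis
  proof cases
    case 1
    then obtain C where "almost_code V {} C" "\<Delta> * card C + card V \<le> \<Delta> * card V"
      unfolding bounded_code_def by auto
    then show ?thesis using ext[of "{}" C 0] A\<Delta> by simp
  next
    case 2
    then obtain C where C: "almost_code V {} C" "\<Delta> * card C + card V \<le> \<Delta> * card V + 1"
      unfolding bounded_code_def by auto
    show ?thesis
    proof (cases "card A + 1 = \<Delta>")
      case False
      then show ?thesis using ext[of "{}" C 0] C A\<Delta> by simp
    next
      case c: True
      have weak: "bounded_code \<Delta> ?W 1" using ext[of "{}" C 1] C c by simp
      show ?thesis
      proof (cases "\<Delta> = 3")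
        case True
        then obtain a b where ab: "A = {a, b}" "a \<noteq> b" using c by (auto simp: card_2_iff)
        have p: "pendant3 V v x a b"
          using A xa aa xv vV ab unfolding pendant3_def by auto
        have WA: "?W = V \<union> {x, a, b}" using ab by simp
        have "exceptional3 V" using 2 True unfolding exceptional_def exceptional3_def by auto
        then have "exceptional3 ?W \<or> gain V v"
          unfolding WA by (rule exceptional3_attach[OF _ fin p]) (use deg True WA in auto)
        then show ?thesis
        proof
          assume "exceptional3 ?W"
          then show ?thesis using weak True unfolding exceptional_def by blast
        next
          assume "gain V v"
          then obtain C where "almost_code V {v} C" "v \<in> C" "3 * card C + 2 \<le> 2 * card V"
            unfolding gain_def by blast
          then show ?thesis using ext[of "{v}" C 0] c True by simp
        qed
      next
        case False
        then have d4: "4 \<le> \<Delta>" using st(3) by simp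
        consider "V = {v}" | "big_star \<Delta> V" using 2(1) vV False unfolding exceptional_def by blast
        then show ?thesis
        proof cases
          case 1
          have W: "?W = insert x (insert v A)" using 1 by blast
          have vA: "v \<notin> A" "x \<noteq> v" using A vV by auto
          have Nx: "nbrs ?W x = insert v A" unfolding W using xv[of v] xa vV E_irrefl by (auto simp: nbrs_def)
          have leaf: "nbrs ?W u = {x}" if "u \<in> insert v A" for u
          proof -
            have "\<not> E v a" if "a \<in> A" for a using aa[OF that, of v] vV E_sym by blast
            moreover have "E u x" using that xa xv[OF vV] E_sym by blast
            ultimately show ?thesis
              unfolding W using that aa[of u] vV E_irrefl by (auto simp: nbrs_def)
          qed
          have "card (insert v A) = \<Delta>" using c A(1) vA by simp
          then have "big_star \<Delta> ?W"
            unfolding big_star_def using Nx leaf W by (intro bexI[of _ x]) auto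
          then show ?thesis using weak d4 unfolding exceptional_def by blast
        next
          case 2
          show ?thesis
            by (rule disjI1, rule big_star_attach[OF 2 d4 fin vV A(1) c A(3-5) xv xa aa]) (use deg vV in auto)
        qed
      qed
    qed
  next
    case 3
    then show ?thesis using ext[OF pair_code[OF st(2) 3 vV], of 0] A\<Delta> st(3) by simp
  qed
qed

text \<open>End stars are cut off with priority, because \<open>exceptional3_weak_gain\<close>
  relies on the whole tree having none when a fork or a path is removed.\<close>

lemma tree_settled:
  assumes "subtree V" "\<And>u. u \<in> V \<Longrightarrow> card (nbrs V u) \<le> \<Delta>" "3 \<le> \<Delta>"
  shows "settled \<Delta> V"
  using assms(1,2)
proof (induction "card V" arbitrary: V rule: less_induct)
  case less
  note st = less.prems(1) and deg = less.prems(2)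
  have fin: "finite V" "V \<noteq> {}" using st by (auto simp: subtree_def)
  have IH: "settled \<Delta> (V - X)" "subtree (V - X)"
    if "v \<in> V - X" "X \<inter> V \<noteq> {}" "\<And>t u. t \<in> X \<Longrightarrow> u \<in> V - X \<Longrightarrow> E t u \<Longrightarrow> u = v" for X v
  proof -
    show s: "subtree (V - X)" using subtree_cut[OF st that(1,3)] .
    have "card (nbrs (V - X) u) \<le> \<Delta>" if "u \<in> V - X" for u
    proof -
      have "card (nbrs (V - X) u) \<le> card (nbrs V u)"
        using fin by (intro card_mono) (auto simp: nbrs_def)
      then show ?thesis using deg[of u] that by simp
    qed
    moreover have "card (V - X) < card V" using fin that(2) by (intro psubset_card_mono) auto
    ultimately show "settled \<Delta> (V - X)" using less.hyps s by blast
  qed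
  consider "card V = 1" | "card V = 2" | "3 \<le> card V" using fin card_0_eq[of V] by linarith
  then show ?case
  proof cases
    case 1
    then obtain v where v: "V = {v}" by (auto simp: card_1_singleton_iff)
    then have "almost_code V {} V" unfolding almost_code_iff by auto
    then have "bounded_code \<Delta> V 1" using 1 unfolding bounded_code_def by auto
    then show ?thesis using v unfolding settled_def exceptional_def by blast
  next
    case 2
    then show ?thesis by (simp add: settled_def)
  next
    case c3: 3
    show ?thesis
    proof (cases "\<exists>x y. end_star V x y")
      case True
      then obtain x y where xy: "x \<in> V" "y \<in> V" "E x y" "3 \<le> card (nbrs V x)"
        "\<And>u. u \<in> nbrs V x - {y} \<Longrightarrow> nbrs V u = {x}" unfolding end_star_def by blast
      let ?A = "nbrs V x - {y}"
      let ?V = "V - insert x ?A"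
      have yN: "y \<in> nbrs V x" "x \<noteq> y" using xy E_irrefl by (auto simp: nbrs_def)
      have AV: "?A \<subseteq> V" "x \<notin> ?A" using E_irrefl by (auto simp: nbrs_def)
      have finA: "finite ?A" using AV fin finite_subset by blast
      have leaf: "u = x" if "a \<in> ?A" "u \<in> V" "E a u" for a u
        using xy(5)[OF that(1)] that(2,3) unfolding nbrs_def by blast
      have yV: "y \<in> ?V" using yN xy by blast
      have cut: "u = y" if "t \<in> insert x ?A" "u \<in> ?V" "E t u" for t u
        using that leaf[of t u] by (auto simp: nbrs_def)
      have ne: "insert x ?A \<inter> V \<noteq> {}" using xy(1) by blast
      have I: "settled \<Delta> ?V" "subtree ?V" using IH[OF yV ne] cut by blast+
      have V: "V = ?V \<union> insert x ?A" using AV xy(1) by blast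
      have cA: "card ?A + 1 = card (nbrs V x)"
        using card.remove[OF _ yN(1)] finA by simp
      have xA: "E x a" if "a \<in> ?A" for a using that by (simp add: nbrs_def)
      have "bounded_code \<Delta> (?V \<union> insert x ?A) 0 \<or>
          exceptional \<Delta> (?V \<union> insert x ?A) \<and> bounded_code \<Delta> (?V \<union> insert x ?A) 1"
      proof (rule star_attach_settled[of \<Delta> ?V y])
        show "settled \<Delta> ?V" "subtree ?V" using I .
        show "2 \<le> card ?A" "card ?A + 1 \<le> \<Delta>" using cA xy(1,4) deg[of x] by auto
        show "E x u \<longleftrightarrow> u = y" if "u \<in> ?V" for u using that xy(3) cut[of x u] by blast
        show "\<not> E a u" if "a \<in> ?A" "u \<in> ?V \<union> ?A" for a u using leaf[of a u] that AV by blast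
        show "card (nbrs (?V \<union> insert x ?A) u) \<le> \<Delta>" if "u \<in> ?V \<union> insert x ?A" for u
          using deg[of u] that unfolding V[symmetric] by simp
      qed (use assms(3) finA yV AV xA in auto)
      then show ?thesis using V unfolding settled_def by metis
    next
      case False
      then have no: "\<not> end_star V x y" for x y by blast
      \<comment> \<open>Fork and path are treated together, since both trade three vertices for two
        code vertices and repair the attachment vertex.\<close>
      have three: "settled \<Delta> V"
        if "X \<subseteq> V" "card X = 3" "v \<in> V - X" "\<And>t u. t \<in> X \<Longrightarrow> u \<in> V - X \<Longrightarrow> E t u \<Longrightarrow> u = v"
          "s \<in> X" "E v s"
          "\<And>U C. almost_code (V - X) U C \<Longrightarrow> \<exists>C'. almost_code V (U - {v}) C' \<and> card C' = card C + 2"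
          "V - X = {v} \<Longrightarrow> exceptional3 V" for X v s
      proof -
        have ne: "X \<inter> V \<noteq> {}" using that by blast
        have fX: "finite X" using that(2) card.infinite by fastforce
        have card: "card V = card (V - X) + 3"
          using card_Diff_subset[OF fX that(1)] card_mono[OF fin(1) that(1)] that(2) by simp
        have "bounded_code \<Delta> V 0 \<or> exceptional \<Delta> V \<and> bounded_code \<Delta> V 1"
        proof (rule extend_by_three[OF IH(1) IH(2) assms(3) that(3) card that(7,8)])
          assume d: "\<Delta> = 3" and ex: "exceptional3 (V - X)"
          show "V - X = {v} \<or> weak_gain (V - X) v"
          proof (rule exceptional3_weak_gain[OF ex fin(1) _ that(3) _ _ that(6) _ no])
            show "r = v" if "t \<in> V - (V - X)" "r \<in> V - X" "E t r" for t r
              using that \<open>\<And>t u. t \<in> X \<Longrightarrow> u \<in> V - X \<Longrightarrow> E t u \<Longrightarrow> u = v\<close> by blast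
            show "s \<in> V - (V - X)" using that(1,5) by blast
            show "card (nbrs V u) \<le> 3" if "u \<in> V" for u using deg d that by blast
          qed blast
        qed (use that ne in blast)+
        then show ?thesis unfolding settled_def by blast
      qed
      from st c3 no show ?thesis
      proof (cases rule: end_structure)
        case (P3 w x y)
        have "almost_code V {} {w, y}" unfolding P3(1) almost_code_iff using P3 E_sym[of w x] E_sym[of x y] E_sym[of y w] by auto
        moreover have "card {w, y} = 2" "card V = 3" using P3 by auto
        ultimately have "bounded_code \<Delta> V 0" using assms(3) unfolding bounded_code_def by (intro exI[of _ "{w, y}"]) auto
        then show ?thesis unfolding settled_def by blast
      next
        case (double w x y w' x')
        have nb: "E w u \<longleftrightarrow> u = x" "E x u \<longleftrightarrow> u = w \<or> u = y" "E w' u \<longleftrightarrow> u = x'" "E x' u \<longleftrightarrow> u = w' \<or> u = y" if "u \<in> V" for u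
          using double(3-6) that unfolding nbrs_def by blast+
        let ?V = "V - {w, x}"
        have cut: "u = y" if "t \<in> {w, x}" "u \<in> ?V" "E t u" for t u using that nb by auto
        have yV: "y \<in> ?V" using double(1,2) by auto
        \<comment> \<open>Only one of the two branches is removed. The branch \<open>x'\<close>,
          \<open>w'\<close> stays and forces \<open>y\<close> into every code, which makes the
          removed branch cheap.\<close>
        have I: "settled \<Delta> ?V" using IH(1)[OF yV _ cut] double(2) by auto
        have V: "V = ?V \<union> {w, x}" using double(2) by blast
        have "{y, w', x'} \<subseteq> ?V" using double(1,2) by auto
        then have "card {y, w', x'} \<le> card ?V" using fin by (intro card_mono) auto
        then have n2: "card ?V \<noteq> 2" using double(1) by auto
        have "bounded_code \<Delta> ?V 1" using I n2 bounded_code_mono[of \<Delta> ?V 0 1] unfolding settled_def by auto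
        then obtain C where C: "almost_code ?V {} C" "\<Delta> * card C + card ?V \<le> \<Delta> * card ?V + 1"
          unfolding bounded_code_def by blast
        have yC: "y \<in> C"
        proof -
          have "w' \<in> ?V" "x' \<in> ?V" "w' \<noteq> x'" using double(1,2) by auto
          then obtain d where d: "d \<in> C" "(w' = d \<or> E w' d) \<noteq> (x' = d \<or> E x' d)"
            using C(1) unfolding almost_code_iff by blast
          moreover have "d \<in> V" using d C(1) unfolding almost_code_iff by blast
          ultimately have "d = y" using nb(3,4)[of d] by blast
          then show ?thesis using d by simp
        qed
        obtain C' where C': "almost_code (?V \<union> {w, x}) {} C'" "card C' = card C + 1"
        proof (rule edge_extend[OF C(1) _ yV yC, of w x])
          show "E w x" using nb(1)[of x] double(2) by simp
          show "E x u \<longleftrightarrow> u = y" if "u \<in> ?V" for u using that nb by auto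
          show "\<not> E w u" if "u \<in> ?V" for u using that nb by auto
        qed (use fin in auto)
        have "card V = card ?V + 2" using fin double(1,2) card_Diff_subset[of "{w, x}" V] card_mono[of V "{w, x}"] by auto
        \<comment> \<open>One code vertex for two vertices leaves
          \<open>\<Delta> - 2 \<ge> 1\<close> to spare, enough for a possible excess 1 of the
          smaller tree.\<close>
        then have "bounded_code \<Delta> V 0"
          using C' C(2) assms(3) V unfolding bounded_code_def by (intro exI[of _ C']) (auto simp: algebra_simps)
        then show ?thesis unfolding settled_def by blast
      next
        case (fork w x y b)
        have nb: "E w u \<longleftrightarrow> u = x" "E x u \<longleftrightarrow> u = w \<or> u = y" "E b u \<longleftrightarrow> u = y" if "u \<in> V" for u
          using fork(3-5) that unfolding nbrs_def by blast+
        let ?X = "{w, x, b}"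
        have V: "V = (V - ?X) \<union> ?X" using fork(2) by blast
        have inV: "w \<in> V" "x \<in> V" "y \<in> V" "b \<in> V" using fork(2) by auto
        have ds: "w \<noteq> x" "w \<noteq> y" "w \<noteq> b" "x \<noteq> y" "x \<noteq> b" "y \<noteq> b" using fork(1) by auto
        show ?thesis
        proof (rule three[of ?X y x])
          show "u = y" if "t \<in> ?X" "u \<in> V - ?X" "E t u" for t u using that nb by auto
          show "E y x" using nb(2)[of y] inV E_sym[of x y] by simp
          show "\<exists>C'. almost_code V (U - {y}) C' \<and> card C' = card C + 2" if al: "almost_code (V - ?X) U C" for U C
          proof -
            obtain C' where "almost_code (V - ?X \<union> ?X) (U - {y}) C'" "card C' = card C + 2"
              by (rule fork_extend[OF al, of y w x b]) (use fin nb inV ds in auto)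
            then show ?thesis using V by metis
          qed
          show "exceptional3 V" if "V - ?X = {y}"
          proof -
            have "V = {w, x, y, b}" using that V by blast
            moreover have "path4 w x y b" unfolding path4_def using nb inV ds E_sym[of b y] by auto
            ultimately have "path_tree V w x y b" unfolding path_tree_def using hung.core by metis
            then show ?thesis unfolding exceptional3_def by blast
          qed
        qed (use inV ds in auto)
      next
        case (path w x y z)
        have nb: "E w u \<longleftrightarrow> u = x" "E x u \<longleftrightarrow> u = w \<or> u = y" "E y u \<longleftrightarrow> u = x \<or> u = z" if "u \<in> V" for u
          using path(3-5) that unfolding nbrs_def by blast+
        let ?X = "{w, x, y}"
        have V: "V = (V - ?X) \<union> ?X" using path(2) by blast
        have inV: "w \<in> V" "x \<in> V" "y \<in> V" "z \<in> V" using path(2) by auto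
        have ds: "w \<noteq> x" "w \<noteq> y" "w \<noteq> z" "x \<noteq> y" "x \<noteq> z" "y \<noteq> z" using path(1) by auto
        show ?thesis
        proof (rule three[of ?X z y])
          show "u = z" if "t \<in> ?X" "u \<in> V - ?X" "E t u" for t u using that nb by auto
          show "E z y" using nb(3)[of z] inV E_sym[of y z] by simp
          show "\<exists>C'. almost_code V (U - {z}) C' \<and> card C' = card C + 2" if al: "almost_code (V - ?X) U C" for U C
          proof -
            obtain C' where "almost_code (V - ?X \<union> ?X) (U - {z}) C'" "card C' = card C + 2"
              by (rule path_extend[OF al, of z w x y]) (use fin nb inV ds in auto)
            then show ?thesis using V by metis
          qed
          show "exceptional3 V" if "V - ?X = {z}"
          proof -
            have "V = {w, x, y, z}" using that V by blast
            moreover have "path4 w x y z" unfolding path4_def using nb inV ds by auto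
            ultimately have "path_tree V w x y z" unfolding path_tree_def using hung.core by metis
            then show ?thesis unfolding exceptional3_def by blast
          qed
        qed (use inV ds in auto)
      qed
    qed
  qed
qed

section \<open>Lower bound on codes of the exceptional trees\<close>

lemma code_pendant3:
  assumes C: "almost_code (W \<union> {x, a, b}) {} C" and p: "pendant3 W v x a b"
  shows "\<not> (a \<notin> C \<and> b \<notin> C)" "\<not> (x \<notin> C \<and> a \<notin> C)" "\<not> (x \<notin> C \<and> b \<notin> C)"
    "v \<notin> C \<Longrightarrow> a \<in> C" "v \<notin> C \<Longrightarrow> b \<in> C"
proof -
  let ?V = "W \<union> {x, a, b}"
  note pe = pendant3_edges[OF p]
  have nb: "x = d \<or> E x d \<longleftrightarrow> d \<in> {x, a, b, v}" "a = d \<or> E a d \<longleftrightarrow> d \<in> {a, x}" "b = d \<or> E b d \<longleftrightarrow> d \<in> {b, x}"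
    if "d \<in> ?V" for d using that pe E_irrefl p by (auto simp: pendant3_def)
  have CV: "C \<subseteq> ?V" using C by (simp add: almost_code_def)
  have dom: "\<exists>d\<in>C. d \<in> ?V \<and> (u = d \<or> E u d)" if u: "u \<in> ?V" for u
  proof -
    obtain d where "d \<in> C" "u = d \<or> E u d" using C u unfolding almost_code_iff by blast
    then show ?thesis using CV by blast
  qed
  have sep: "\<exists>d\<in>C. d \<in> ?V \<and> (u = d \<or> E u d) \<noteq> (t = d \<or> E t d)"
    if u: "u \<in> ?V" and t: "t \<in> ?V" "u \<noteq> t" for u t
  proof -
    obtain d where "d \<in> C" "(u = d \<or> E u d) \<noteq> (t = d \<or> E t d)"
      using C u t unfolding almost_code_iff by blast
    then show ?thesis using CV by blast
  qed
  \<comment> \<open>The closed neighbourhoods of \<open>a\<close> and \<open>b\<close> differ in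
    \<open>a\<close> and \<open>b\<close> only, those of \<open>x\<close> and \<open>b\<close> in
    \<open>a\<close> and \<open>v\<close> only, and \<open>a\<close> is dominated by
    \<open>a\<close> and \<open>x\<close> only; the other cases are symmetric.\<close>
  show "\<not> (a \<notin> C \<and> b \<notin> C)" using sep[of a b] nb pe(3) by auto
  show "\<not> (x \<notin> C \<and> a \<notin> C)" using dom[of a] nb by auto
  show "\<not> (x \<notin> C \<and> b \<notin> C)" using dom[of b] nb by auto
  show "a \<in> C" if "v \<notin> C" using sep[of x b] nb pe(2) that by auto
  show "b \<in> C" if "v \<notin> C" using sep[of x a] nb pe(1) that by auto
qed

text \<open>Each hung star omits at most one vertex. A star that keeps its centre cannot omit anything when it
  hangs at an omitted vertex, and this loss pays for that vertex.\<close>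

lemma hung_omitted:
  assumes "hung K Z V" "Z \<subseteq> K" "finite K"
    and "\<And>W v x a b. V = W \<union> {x, a, b} \<Longrightarrow> hung K Z W \<Longrightarrow> v \<in> Z \<Longrightarrow> pendant3 W v x a b \<Longrightarrow>
      card (S \<inter> {x, a, b}) \<le> 1 \<and> (v \<in> S \<longrightarrow> a \<notin> S \<and> b \<notin> S)"
  shows "3 * (card (S \<inter> (V - K)) + card {l \<in> Z \<inter> S. \<exists>u\<in>V - K. E l u \<and> u \<notin> S}) + card K \<le> card V"
  using assms(1,4)
proof (induction rule: hung.induct)
  case core
  then show ?case by simp
next
  case (hang V v x a b)
  note p = hang.hyps(3) and pe = pendant3_edges[OF hang.hyps(3)]
  have KV: "K \<subseteq> V" using hung_subset[OF hang.hyps(1)] .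
  have fin: "finite V" using hung_finite[OF hang.hyps(1) assms(3)] .
  have finZ: "finite Z" using assms(2,3) finite_subset by blast
  let ?B = "\<lambda>V. {l \<in> Z \<inter> S. \<exists>u\<in>V - K. E l u \<and> u \<notin> S}"
  let ?V = "V \<union> {x, a, b}"
  have star: "card (S \<inter> {x, a, b}) \<le> 1" "v \<in> S \<Longrightarrow> a \<notin> S \<and> b \<notin> S"
    using hang.prems[OF refl hang.hyps] by auto
  \<comment> \<open>Every star of \<open>V\<close> can be made the last star of the larger tree, so
    the assumption about last stars passes down to \<open>V\<close>.\<close>
  have ih: "3 * (card (S \<inter> (V - K)) + card (?B V)) + card K \<le> card V"
  proof (rule hang.IH)
    fix W v' x' a' b'
    assume W: "V = W \<union> {x', a', b'}" "hung K Z W" "v' \<in> Z" "pendant3 W v' x' a' b'"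
    have "v \<in> W" using hung_subset[OF W(2)] hang.hyps(2) assms(2) by blast
    then have ex: "pendant3 W v x a b" "pendant3 (W \<union> {x, a, b}) v' x' a' b'"
      using pendant3_exchange[OF W(4), of v x a b] p W(1) by simp_all
    have "?V = W \<union> {x, a, b} \<union> {x', a', b'}" using W(1) by blast
    then show "card (S \<inter> {x', a', b'}) \<le> 1 \<and> (v' \<in> S \<longrightarrow> a' \<notin> S \<and> b' \<notin> S)"
      using hang.prems[of "W \<union> {x, a, b}" x' a' b' v'] hung.hang[OF W(2) hang.hyps(2) ex(1)] W(3) ex(2) by blast
  qed
  have S: "card (S \<inter> (?V - K)) = card (S \<inter> (V - K)) + card (S \<inter> {x, a, b})"
  proof -
    have "S \<inter> (?V - K) = S \<inter> (V - K) \<union> S \<inter> {x, a, b}" using KV p unfolding pendant3_def by blast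
    moreover have "S \<inter> (V - K) \<inter> (S \<inter> {x, a, b}) = {}" using p unfolding pendant3_def by blast
    ultimately show ?thesis using fin by (simp add: card_Un_disjoint)
  qed
  have finB: "finite (?B V)" using finZ by simp
  have new: "l = v \<and> u = x" if "l \<in> Z" "u \<in> {x, a, b}" "E l u" for l u
    using that pe(22,25,26)[of l] KV assms(2) by blast
  \<comment> \<open>If \<open>v\<close> is omitted and \<open>x\<close> is not, the star omits
    nothing and at most \<open>v\<close> is newly counted. Otherwise nothing is newly counted and
    the star omits at most one vertex.\<close>
  have "card (S \<inter> {x, a, b}) + card (?B ?V) \<le> card (?B V) + 1"
  proof (cases "v \<in> S \<and> x \<notin> S")
    case True
    then have "S \<inter> {x, a, b} = {}" using star(2) by blast
    moreover have "?B ?V \<subseteq> insert v (?B V)" using new by blast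
    then have "card (?B ?V) \<le> card (insert v (?B V))" using finB by (intro card_mono) auto
    moreover have "\<dots> \<le> card (?B V) + 1" using finB by (simp add: card_insert_if)
    ultimately show ?thesis by simp
  next
    case False
    then have "?B ?V \<subseteq> ?B V" using new by blast
    then have "card (?B ?V) \<le> card (?B V)" using finB by (intro card_mono)
    then show ?thesis using star(1) by simp
  qed
  then show ?case using ih S pendant3_card[OF fin p] by simp
qed

lemma hung_code_omitted:
  assumes "hung K Z V" "Z \<subseteq> K" "finite K" "almost_code V {} C"
  shows "3 * (card ((V - C) \<inter> (V - K)) + card {l \<in> Z \<inter> (V - C). \<exists>u\<in>V - K. E l u \<and> u \<in> C}) + card K \<le> card V"
proof -
  have "3 * (card ((V - C) \<inter> (V - K)) + card {l \<in> Z \<inter> (V - C). \<exists>u\<in>V - K. E l u \<and> u \<notin> V - C}) + card K \<le> card V"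
  proof (rule hung_omitted[OF assms(1-3)])
    fix W v x a b
    assume W: "V = W \<union> {x, a, b}" "pendant3 W v x a b"
    note c = code_pendant3[OF assms(4)[unfolded W(1)] W(2)]
    have "\<exists>s. (V - C) \<inter> {x, a, b} \<subseteq> {s}" using c(1-3) by blast
    then obtain s where "(V - C) \<inter> {x, a, b} \<subseteq> {s}" by blast
    then have "card ((V - C) \<inter> {x, a, b}) \<le> card {s}" by (intro card_mono) auto
    then show "card ((V - C) \<inter> {x, a, b}) \<le> 1 \<and> (v \<in> V - C \<longrightarrow> a \<notin> V - C \<and> b \<notin> V - C)"
      using c(4,5) by simp
  qed
  moreover have "{l \<in> Z \<inter> (V - C). \<exists>u\<in>V - K. E l u \<and> u \<notin> V - C} = {l \<in> Z \<inter> (V - C). \<exists>u\<in>V - K. E l u \<and> u \<in> C}"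
    by blast
  ultimately show ?thesis by simp
qed

text \<open>The stars pay for omitted vertices outside the core and for omitted legs next to a coded
  star centre. Any other omitted leg sees only \<open>c\<close> in the code; so there is at most one
  such leg, and if there is one then \<open>c\<close> is coded. The four core vertices thus pay for
  at most one omitted vertex.\<close>

lemma claw_tree_code_bound:
  assumes "claw_tree V c l m n" "almost_code V {} C"
  shows "3 * card (V - C) + 1 \<le> card V"
proof -
  let ?K = "{c, l, m, n}" and ?Z = "{l, m, n}" and ?S = "V - C"
  have h: "claw c l m n" "hung ?K ?Z V" using assms(1) by (auto simp: claw_tree_def)
  note ce = claw_edges[OF h(1)]
  have KV: "?K \<subseteq> V" and fin: "finite V" using hung_subset[OF h(2)] hung_finite[OF h(2)] by simp_all
  have CV: "C \<subseteq> V" using assms(2) by (simp add: almost_code_def)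
  let ?B = "{t \<in> ?Z \<inter> ?S. \<exists>u\<in>V - ?K. E t u \<and> u \<in> C}"
  let ?D = "{t \<in> ?Z \<inter> ?S. \<not> (\<exists>u\<in>V - ?K. E t u \<and> u \<in> C)}"
  have main: "3 * (card (?S \<inter> (V - ?K)) + card ?B) + card ?K \<le> card V"
    by (rule hung_code_omitted[OF h(2) _ _ assms(2)]) auto
  have onlyc: "d = c" if "t \<in> ?D" "d \<in> C" "t = d \<or> E t d" for t d
    using that CV ce by auto
  have cC: "c \<in> C" if t: "t \<in> ?D" for t
  proof -
    have "t \<in> V" using t by blast
    then obtain d where "d \<in> C" "t = d \<or> E t d" using assms(2) unfolding almost_code_iff by blast
    then show ?thesis using onlyc[OF t] by blast
  qed
  have D1: "s = t" if s: "s \<in> ?D" and t: "t \<in> ?D" for s t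
  proof (rule ccontr)
    assume "s \<noteq> t"
    moreover have "s \<in> V" "t \<in> V" using s t by blast+
    ultimately obtain d where d: "d \<in> C" "(s = d \<or> E s d) \<noteq> (t = d \<or> E t d)"
      using assms(2) unfolding almost_code_iff by blast
    then have "d = c" using onlyc[OF s] onlyc[OF t] by blast
    moreover have "E s c" "E t c" using s t ce by auto
    ultimately show False using d by blast
  qed
  have h1: "card (?S \<inter> {c}) + card ?D \<le> 1"
  proof (cases "?D = {}")
    case True
    have "card (?S \<inter> {c}) \<le> card {c}" by (intro card_mono) auto
    then show ?thesis unfolding True by simp
  next
    case False
    then obtain t where t: "t \<in> ?D" by blast
    then have "?S \<inter> {c} = {}" using cC by blast
    moreover have "?D \<subseteq> {t}" using D1 t by blast
    then have "card ?D \<le> card {t}" by (intro card_mono) auto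
    ultimately show ?thesis by simp
  qed
  have h2: "card ?S \<le> card (?S \<inter> (V - ?K)) + (card (?S \<inter> {c}) + (card ?B + card ?D))"
  proof -
    have "?S \<subseteq> (?S \<inter> (V - ?K)) \<union> ((?S \<inter> {c}) \<union> (?B \<union> ?D))" by blast
    then have "card ?S \<le> card ((?S \<inter> (V - ?K)) \<union> ((?S \<inter> {c}) \<union> (?B \<union> ?D)))"
      using fin by (intro card_mono) auto
    then show ?thesis using card_Un_le by (meson add_left_mono le_trans)
  qed
  have arith: "3 * t + 1 \<le> N"
    if "d + f \<le> 1" "t \<le> s + (d + (b + f))" "3 * (s + b) + 4 \<le> N" for b d f s t N :: nat
    using that by presburger
  have "card ?K = 4" using ce by simp
  then show ?thesis using arith[OF h1 h2] main by simp
qed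

text \<open>Separating \<open>w\<close> from \<open>x\<close> forces \<open>y\<close>, and
  dominating \<open>w\<close> forces \<open>w\<close> or \<open>x\<close>. An omitted
  \<open>z\<close> is paid for by a star with coded centre; without one, \<open>x\<close> is needed
  to separate \<open>y\<close> from \<open>z\<close>, and then \<open>w\<close> to separate
  \<open>x\<close> from \<open>y\<close>.\<close>

lemma path_tree_code_bound:
  assumes "path_tree V w x y z" "almost_code V {} C"
  shows "3 * card (V - C) + 1 \<le> card V"
proof -
  let ?K = "{w, x, y, z}" and ?S = "V - C"
  have h: "path4 w x y z" "hung ?K {z} V" using assms(1) by (auto simp: path_tree_def)
  note pe = path4_edges[OF h(1)]
  have KV: "?K \<subseteq> V" and fin: "finite V" using hung_subset[OF h(2)] hung_finite[OF h(2)] by simp_all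
  have CV: "C \<subseteq> V" using assms(2) by (simp add: almost_code_def)
  let ?B = "{t \<in> {z} \<inter> ?S. \<exists>u\<in>V - ?K. E t u \<and> u \<in> C}"
  have main: "3 * (card (?S \<inter> (V - ?K)) + card ?B) + card ?K \<le> card V"
    by (rule hung_code_omitted[OF h(2) _ _ assms(2)]) auto
  have inner: "\<not> E k u" if "k \<in> {w, x, y}" "u \<in> V - ?K" for k u
    using hung_core_nbrs[OF h(2), of k u] that pe by auto
  have nb: "w = d \<or> E w d \<longleftrightarrow> d \<in> {w, x}" "x = d \<or> E x d \<longleftrightarrow> d \<in> {w, x, y}" "y = d \<or> E y d \<longleftrightarrow> d \<in> {x, y, z}"
    "d \<in> ?K \<Longrightarrow> z = d \<or> E z d \<longleftrightarrow> d \<in> {y, z}"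
    if "d \<in> C" for d
    using that CV inner[of _ d] pe E_irrefl by auto
  have sep: "\<exists>d\<in>C. (u = d \<or> E u d) \<noteq> (t = d \<or> E t d)" if "u \<in> ?K" "t \<in> ?K" "u \<noteq> t" for u t
  proof -
    have "u \<in> V" "t \<in> V" using that KV by auto
    then show ?thesis using assms(2) that(3) unfolding almost_code_iff by blast
  qed
  have yC: "y \<in> C" using sep[of w x] nb pe by auto
  have "w \<in> V" using KV by blast
  then have wx: "w \<in> C \<or> x \<in> C" using assms(2) nb(1) unfolding almost_code_iff by blast
  have h1: "card (?S \<inter> ?K) \<le> card ?B + 1"
  proof (cases "z \<in> C")
    case True
    then have "?S \<inter> ?K \<subseteq> {w} \<or> ?S \<inter> ?K \<subseteq> {x}" using yC wx by blast
    then have "card (?S \<inter> ?K) \<le> 1" by (auto dest: card_mono[rotated])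
    then show ?thesis by simp
  next
    case zC: False
    show ?thesis
    proof (cases "\<exists>u\<in>V - ?K. E z u \<and> u \<in> C")
      case True
      then have "?B = {z}" using zC KV by blast
      moreover have "?S \<inter> ?K \<subseteq> {w, z} \<or> ?S \<inter> ?K \<subseteq> {x, z}" using yC wx by blast
      then have "card (?S \<inter> ?K) \<le> card {w, z} \<or> card (?S \<inter> ?K) \<le> card {x, z}"
        by (auto dest: card_mono[rotated])
      ultimately show ?thesis using pe by auto
    next
      case False
      obtain d where d: "d \<in> C" "(y = d \<or> E y d) \<noteq> (z = d \<or> E z d)" using sep[of y z] pe by auto
      then have "d \<in> ?K" using False CV nb(3)[OF d(1)] by auto
      then have "d = x" using nb(3,4)[OF d(1)] d(2) zC d(1) by auto
      then have "x \<in> C" using d(1) by simp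
      moreover have "w \<in> C" using sep[of x y] nb zC pe by auto
      ultimately have "?S \<inter> ?K \<subseteq> {z}" using yC by blast
      then have "card (?S \<inter> ?K) \<le> card {z}" by (intro card_mono) auto
      then show ?thesis by simp
    qed
  qed
  have h2: "card ?S \<le> card (?S \<inter> (V - ?K)) + card (?S \<inter> ?K)"
  proof -
    have "?S = (?S \<inter> (V - ?K)) \<union> (?S \<inter> ?K)" by blast
    then show ?thesis using card_Un_le by metis
  qed
  have arith: "3 * t + 1 \<le> N"
    if "d \<le> b + 1" "t \<le> s + d" "3 * (s + b) + 4 \<le> N" for b d s t N :: nat
    using that by presburger
  have "card ?K = 4" using pe by simp
  then show ?thesis using arith[OF h1 h2] main by simp
qed

text \<open>At most one vertex is omitted: two omitted leaves cannot be separated, and an omitted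
  leaf can be dominated only by the centre.\<close>

lemma big_star_code_bound:
  assumes "big_star \<Delta> V" "finite V" "almost_code V {} C"
  shows "\<Delta> * card (V - C) + 1 \<le> card V"
proof -
  obtain c where c: "c \<in> V" "V = insert c (nbrs V c)" "card (nbrs V c) = \<Delta>" "\<And>u. u \<in> nbrs V c \<Longrightarrow> nbrs V u = {c}"
    using assms(1) unfolding big_star_def by blast
  have CV: "C \<subseteq> V" using assms(3) by (simp add: almost_code_def)
  have leaf: "E u d \<longleftrightarrow> d = c" if "u \<in> nbrs V c" "d \<in> V" for u d
    using c(4)[OF that(1)] that(2) unfolding nbrs_def by blast
  have cC: "c \<in> C" if u: "u \<in> nbrs V c" "u \<notin> C" for u
  proof -
    have "u \<in> V" using u by (simp add: nbrs_def)
    then obtain d where "d \<in> C" "u = d \<or> E u d" using assms(3) unfolding almost_code_iff by blast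
    then show ?thesis using leaf[OF u(1)] u(2) CV by blast
  qed
  have one: "u = t" if u: "u \<in> nbrs V c" "u \<notin> C" and t: "t \<in> nbrs V c" "t \<notin> C" for u t
  proof (rule ccontr)
    assume "u \<noteq> t"
    moreover have "u \<in> V" "t \<in> V" using u t by (auto simp: nbrs_def)
    ultimately obtain d where "d \<in> C" "(u = d \<or> E u d) \<noteq> (t = d \<or> E t d)"
      using assms(3) unfolding almost_code_iff by blast
    then show False using leaf u t CV by blast
  qed
  have split: "u = c \<or> u \<in> nbrs V c" if "u \<in> V" for u
    using that by (subst (asm) c(2)) simp
  have "\<exists>s. V - C \<subseteq> {s}"
  proof (cases "c \<in> C")
    case True
    then have "V - C \<subseteq> nbrs V c" using split by blast
    then show ?thesis using one by blast
  next
    case False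
    then have "V - C \<subseteq> {c}" using split cC by blast
    then show ?thesis by blast
  qed
  then obtain s where "V - C \<subseteq> {s}" by blast
  then have "card (V - C) \<le> card {s}" by (intro card_mono) auto
  then have "\<Delta> * card (V - C) \<le> \<Delta> * 1" by (intro mult_le_mono2) simp
  moreover have "finite (nbrs V c)" "c \<notin> nbrs V c" using assms(2) E_irrefl by (auto simp: nbrs_def)
  then have "card V = \<Delta> + 1" using c(2,3) by (metis card_insert_disjoint Suc_eq_plus1)
  ultimately show ?thesis by simp
qed

end

section \<open>The family up to isomorphism\<close>

lemma graph_iso_inverse:
  assumes g: "bij_betw g W V" and e: "\<And>i j. i \<in> W \<Longrightarrow> j \<in> W \<Longrightarrow> F i j \<longleftrightarrow> E (g i) (g j)"
  shows "graph_iso V E W F"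
proof -
  let ?f = "inv_into W g"
  have f: "bij_betw ?f V W" using g by (rule bij_betw_inv_into)
  then have "?f u \<in> W" "g (?f u) = u" if "u \<in> V" for u
    using that g by (auto simp: bij_betw_def f_inv_into_f)
  then show ?thesis unfolding graph_iso_def using f e by (intro exI[of _ ?f]) auto
qed

lemma graph_iso_sym:
  assumes "graph_iso V E W F"
  shows "graph_iso W F V E"
proof -
  obtain f where "bij_betw f V W" "\<forall>u\<in>V. \<forall>v\<in>V. E u v \<longleftrightarrow> F (f u) (f v)"
    using assms by (auto simp: graph_iso_def)
  then show ?thesis by (intro graph_iso_inverse) auto
qed

lemma iso_walk:
  assumes f: "bij_betw f V W" "\<forall>u\<in>V. \<forall>v\<in>V. E u v \<longleftrightarrow> F (f u) (f v)" and p: "walk V E p"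
  shows "walk W F (map f p)"
proof -
  have "p ! i \<in> V" if "i < length p" for i using p nth_mem[OF that] by (auto simp: walk_def)
  then have "F (f (p ! i)) (f (p ! Suc i))" if "Suc i < length p" for i
    using that p f(2) by (auto simp: walk_def)
  moreover have "f ` set p \<subseteq> W" using f(1) p by (auto simp: bij_betw_def walk_def)
  ultimately show ?thesis using p by (auto simp: walk_def)
qed

lemma iso_has_cycle:
  assumes "graph_iso V E W F" "has_cycle V E"
  shows "has_cycle W F"
proof -
  obtain f where f: "bij_betw f V W" "\<forall>u\<in>V. \<forall>v\<in>V. E u v \<longleftrightarrow> F (f u) (f v)"
    using assms by (auto simp: graph_iso_def)
  obtain p where p: "walk V E p" "distinct p" "3 \<le> length p" "E (last p) (hd p)"
    using assms by (auto simp: has_cycle_def)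
  have ne: "p \<noteq> []" "set p \<subseteq> V" using p by (auto simp: walk_def)
  then have "hd p \<in> V" "last p \<in> V" by auto
  then have "F (last (map f p)) (hd (map f p))" using p f(2) ne by (simp add: last_map hd_map)
  moreover have "distinct (map f p)" using p(2) f(1) ne by (auto simp: distinct_map bij_betw_def intro: inj_on_subset)
  ultimately show ?thesis using iso_walk[OF f p(1)] p(3) unfolding has_cycle_def by (intro exI[of _ "map f p"]) auto
qed

lemma iso_diam_le:
  assumes "graph_iso V E W F" "diam_le V E k"
  shows "diam_le W F k"
  unfolding diam_le_def
proof (intro ballI)
  obtain f where f: "bij_betw f V W" "\<forall>u\<in>V. \<forall>v\<in>V. E u v \<longleftrightarrow> F (f u) (f v)"
    using assms by (auto simp: graph_iso_def)
  fix s t assume "s \<in> W" "t \<in> W"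
  then obtain u v where uv: "u \<in> V" "v \<in> V" "s = f u" "t = f v" using f(1) by (auto simp: bij_betw_def)
  then obtain p where "walk V E p" "hd p = u" "last p = v" "length p \<le> Suc k"
    using assms(2) by (auto simp: diam_le_def)
  moreover from this have "p \<noteq> []" by (simp add: walk_def)
  ultimately show "\<exists>p. walk W F p \<and> hd p = s \<and> last p = t \<and> length p \<le> Suc k"
    using iso_walk[OF f] uv by (intro exI[of _ "map f p"]) (auto simp: hd_map last_map)
qed

lemma iso_max_degree:
  assumes "graph_iso V E W F"
  shows "max_degree W F = max_degree V E"
proof -
  obtain f where f: "bij_betw f V W" "\<forall>u\<in>V. \<forall>v\<in>V. E u v \<longleftrightarrow> F (f u) (f v)"
    using assms by (auto simp: graph_iso_def)
  have W: "W = f ` V" and inj: "inj_on f V" using f(1) by (auto simp: bij_betw_def)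
  have "degree W F (f u) = degree V E u" if u: "u \<in> V" for u
  proof -
    have "{w \<in> W. F (f u) w} = f ` {v \<in> V. E u v}" using f(2) u W by auto
    then show ?thesis unfolding degree_def using inj by (metis (no_types, lifting) card_image inj_on_subset mem_Collect_eq subsetI)
  qed
  then have "degree W F ` W = degree V E ` V" unfolding W image_image by (intro image_cong) auto
  then show ?thesis by (simp add: max_degree_def)
qed

lemma iso_identifying_code:
  assumes f: "bij_betw f V W" "\<forall>u\<in>V. \<forall>v\<in>V. E u v \<longleftrightarrow> F (f u) (f v)"
    and C: "identifying_code V E C"
  shows "identifying_code W F (f ` C)"
proof -
  have W: "W = f ` V" and inj: "inj_on f V" using f(1) by (auto simp: bij_betw_def)
  have CV: "C \<subseteq> V" using C by (simp add: identifying_code_def)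
  have nb: "closed_nbhd W F (f v) \<inter> f ` C = f ` (closed_nbhd V E v \<inter> C)" if v: "v \<in> V" for v
  proof -
    have N: "closed_nbhd W F (f v) = f ` closed_nbhd V E v"
      unfolding closed_nbhd_def W using f(2) v by auto
    have "closed_nbhd V E v \<subseteq> V" using v by (auto simp: closed_nbhd_def)
    then show ?thesis unfolding N using inj_on_image_Int[OF inj] CV by simp
  qed
  have sub: "closed_nbhd V E v \<inter> C \<subseteq> V" for v using CV by blast
  show ?thesis unfolding identifying_code_def
  proof (intro conjI ballI impI)
    show "f ` C \<subseteq> W" using CV W by blast
    show "closed_nbhd W F s \<inter> f ` C \<noteq> {}" if "s \<in> W" for s
      using that C nb unfolding W identifying_code_def by auto
    show "closed_nbhd W F s \<inter> f ` C \<noteq> closed_nbhd W F t \<inter> f ` C" if st: "s \<in> W" "t \<in> W" "s \<noteq> t" for s t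
    proof -
      obtain u v where uv: "u \<in> V" "v \<in> V" "s = f u" "t = f v" using st W by blast
      have "u \<noteq> v" using uv(3,4) st(3) by auto
      then have "closed_nbhd V E u \<inter> C \<noteq> closed_nbhd V E v \<inter> C"
        using C uv(1,2) unfolding identifying_code_def by blast
      then show ?thesis unfolding uv(3,4) nb[OF uv(1)] nb[OF uv(2)] inj_on_image_eq_iff[OF inj sub sub] .
    qed
  qed
qed

lemma iso_code_bound:
  assumes iso: "graph_iso V E W F"
    and W: "\<And>C. identifying_code W F C \<Longrightarrow> \<Delta> * card (W - C) + 1 \<le> card W"
    and C: "identifying_code V E C"
  shows "\<Delta> * card (V - C) + 1 \<le> card V"
proof -
  obtain f where f: "bij_betw f V W" "\<forall>u\<in>V. \<forall>v\<in>V. E u v \<longleftrightarrow> F (f u) (f v)"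
    using iso by (auto simp: graph_iso_def)
  have CV: "C \<subseteq> V" using C by (simp add: identifying_code_def)
  have "f ` (V - C) = f ` V - f ` C" using f(1) CV by (intro inj_on_image_set_diff[of f V]) (auto simp: bij_betw_def)
  then have "W - f ` C = f ` (V - C)" using f(1) by (simp add: bij_betw_def)
  moreover have "card (f ` (V - C)) = card (V - C)"
    using f(1) by (auto simp: bij_betw_def intro: card_image inj_on_subset)
  moreover have "card W = card V" using bij_betw_same_card[OF f(1)] by simp
  ultimately show ?thesis using W[OF iso_identifying_code[OF f C]] by simp
qed

section \<open>Claw trees as appended 3-stars of small diameter\<close>

lemma appended3_graph:
  "appended3 V E \<Longrightarrow> finite V \<and> (\<forall>u v. E u v \<longrightarrow> u \<in> V \<and> v \<in> V \<and> E v u) \<and> (\<forall>v. \<not> E v v)"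
  by (induction rule: appended3.induct) (auto simp: adj_of_def)

lemma appended3_sgraph: "appended3 V E \<Longrightarrow> sgraph E"
  using appended3_graph[of V E] by unfold_locales auto

context sgraph begin

text \<open>If \<open>p\<close> does not begin with the first edge of \<open>q\<close>, then the
  second vertex of \<open>q\<close> can be put in front of \<open>p\<close>. This longer path is
  compared with the shorter rest of \<open>q\<close>, so the induction hypothesis gives even more
  than required.\<close>

lemma walk_shortest:
  assumes nc: "\<not> has_cycle V E"
  shows "walk V E q \<Longrightarrow> walk V E p \<Longrightarrow> distinct p \<Longrightarrow> hd p = hd q \<Longrightarrow> last p = last q \<Longrightarrow> length p \<le> length q"
proof (induction q arbitrary: p rule: induct_list012)
  case 1
  then show ?case by (simp add: walk_def)
next
  case (2 u)
  then obtain r where "p = u # r" by (cases p) (auto simp: walk_def)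
  then show ?case using 2 by (cases "r = []") auto
next
  case (3 u v q)
  then obtain r where p: "p = u # r" by (cases p) (auto simp: walk_def)
  have uv: "u \<in> V" "E u v" "walk V E (v # q)" using 3 by (auto simp: walk_Cons)
  show ?case
  proof (cases "r \<noteq> [] \<and> hd r = v")
    case True
    then obtain r' where r: "r = v # r'" by (cases r) auto
    then have "length r \<le> length (v # q)"
      using 3 p uv by (intro "3.IH"(2)) (auto simp: walk_Cons)
    then show ?thesis using p by simp
  next
    case False
    then have "v \<notin> set p" using "3.prems" p uv(2) E_sym
      by (intro no_back_edge[OF nc]) (auto simp: hd_conv_nth Suc_le_eq)
    moreover have "v \<in> V" using uv walk_hd by blast
    ultimately have "length (v # p) \<le> length (v # q)"
      using "3.prems" p uv E_sym by (intro "3.IH"(2)) (auto simp: walk_Cons)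
    then show ?thesis by simp
  qed
qed

text \<open>\<open>diam_le\<close> merely provides short walks between any two vertices. In the
  absence of cycles these are no shorter than the path between the same ends, so every path is
  short.\<close>

lemma diam_distinct_walk:
  assumes "\<not> has_cycle V E" "diam_le V E k" "walk V E p" "distinct p"
  shows "length p \<le> Suc k"
proof -
  have "p \<noteq> []" "set p \<subseteq> V" using assms(3) by (auto simp: walk_def)
  then have "hd p \<in> V" "last p \<in> V" by auto
  then obtain q where "walk V E q" "hd q = hd p" "last q = last p" "length q \<le> Suc k"
    using assms(2) unfolding diam_le_def by blast
  then show ?thesis using walk_shortest[OF assms(1) _ assms(3,4)] by fastforce
qed

lemma walk_append: "walk V E (p @ [c]) \<Longrightarrow> walk V E (c # q) \<Longrightarrow> walk V E (p @ c # q)"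
proof (induction p rule: induct_list012)
  case (2 u)
  then show ?case by (simp add: walk_Cons)
next
  case (3 u v p)
  then show ?case by (simp add: walk_Cons)
qed simp

lemma claw_tree_diam:
  assumes "claw_tree V c l m n"
  shows "diam_le V E 6"
proof -
  let ?K = "{c, l, m, n}" and ?Z = "{l, m, n}"
  have h: "claw c l m n" "hung ?K ?Z V" using assms by (auto simp: claw_tree_def)
  have KV: "?K \<subseteq> V" using hung_subset[OF h(2)] .
  note ce = claw_edges[OF h(1)]
  have near: "\<exists>q. length q \<le> 3 \<and> walk V E (c # q) \<and> last (c # q) = u \<and> walk V E (rev q @ [c])" if u: "u \<in> V" for u
  proof (cases "u \<in> ?K")
    case True
    then consider "u = c" | "u \<in> ?Z" by blast
    then show ?thesis
    proof cases
      case 1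
      then show ?thesis using KV by (intro exI[of _ "[]"]) (auto simp: walk_single)
    next
      case 2
      then show ?thesis using KV ce by (intro exI[of _ "[u]"]) (auto simp: walk_single walk_Cons)
    qed
  next
    case False
    obtain W v x a b where W: "V = W \<union> {x, a, b}" "hung ?K ?Z W" "v \<in> ?Z" "pendant3 W v x a b" "u \<in> {x, a, b}"
      by (rule hung_pull[OF h(2), of u]) (use u False in blast)+
    note pe = pendant3_edges[OF W(4)]
    have v: "E c v" "E v c" "v \<in> V" "c \<in> V" "x \<in> V" "a \<in> V" "b \<in> V" using W(1,3) KV ce by auto
    consider "u = x" | "u \<in> {a, b}" using W(5) by blast
    then show ?thesis
    proof cases
      case 1
      then show ?thesis using v pe by (intro exI[of _ "[v, x]"]) (auto simp: walk_single walk_Cons)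
    next
      case 2
      then show ?thesis using v pe by (intro exI[of _ "[v, x, u]"]) (auto simp: walk_single walk_Cons)
    qed
  qed
  show ?thesis unfolding diam_le_def
  proof (intro ballI)
    fix u v assume "u \<in> V" "v \<in> V"
    then obtain q r where q: "length q \<le> 3" "last (c # q) = u" "walk V E (rev q @ [c])"
      and r: "length r \<le> 3" "last (c # r) = v" "walk V E (c # r)" using near by meson
    have "walk V E (rev q @ c # r)" using walk_append q(3) r(3) by blast
    moreover have "hd (rev q @ c # r) = u" using q(2) by (cases "q = []") (auto simp: hd_rev)
    ultimately show "\<exists>p. walk V E p \<and> hd p = u \<and> last p = v \<and> length p \<le> Suc 6"
      using q(1) r(1,2) by (intro exI[of _ "rev q @ c # r"]) auto
  qed
qed

lemma claw_tree_appended: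
  assumes "claw_tree V c l m n"
  shows "\<exists>W F. appended3 W F \<and> graph_iso V E W F"
proof -
  have h: "claw c l m n" "hung {c, l, m, n} {l, m, n} V" using assms by (auto simp: claw_tree_def)
  note ce = claw_edges[OF h(1)]
  have "\<exists>W F f. appended3 W F \<and> bij_betw f V W \<and> (\<forall>u\<in>V. \<forall>v\<in>V. E u v \<longleftrightarrow> F (f u) (f v))"
    using h(2)
  proof (induction rule: hung.induct)
    case core
    let ?g = "(!) [c, l, m, n]"
    let ?F = "adj_of {(0::nat, 1::nat), (0, 2), (0, 3)}"
    have "graph_iso {c, l, m, n} E {0, 1, 2, 3} ?F"
    proof (rule graph_iso_inverse)
      show "bij_betw ?g {0, 1, 2, 3} {c, l, m, n}"
        using ce by (intro bij_betw_nth) auto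
      have "\<forall>i\<in>{0, 1, 2, 3}. \<forall>j\<in>{0, 1, 2, 3}. ?F i j \<longleftrightarrow> E (?g i) (?g j)"
        using ce E_irrefl by (simp add: adj_of_def)
      then show "?F i j \<longleftrightarrow> E (?g i) (?g j)" if "i \<in> {0, 1, 2, 3}" "j \<in> {0, 1, 2, 3}" for i j
        using that by blast
    qed
    moreover have "appended3 {0, 1, 2, 3} ?F" by (rule appended3.base) simp
    ultimately show ?case unfolding graph_iso_def by blast
  next
    case (hang V v x a b)
    note p = hang.hyps(3) and pe = pendant3_edges[OF hang.hyps(3)]
    obtain W F f where W: "appended3 W F" "bij_betw f V W" "\<forall>u\<in>V. \<forall>v\<in>V. E u v \<longleftrightarrow> F (f u) (f v)"
      using hang.IH by blast
    have finW: "finite W" and FW: "\<And>p q. F p q \<Longrightarrow> p \<in> W \<and> q \<in> W" using appended3_graph[OF W(1)] by blast+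
    obtain k where k: "\<And>w. w \<in> W \<Longrightarrow> w < k" using finW by (metis finite_nat_set_iff_bounded)
    have vV: "v \<in> V" using p by (simp add: pendant3_def)
    have fW: "f u \<in> W" if "u \<in> V" for u using W(2) that by (auto simp: bij_betw_def)
    have fv: "f u = f v \<longleftrightarrow> u = v" if "u \<in> V" for u
      using W(2) that vV by (auto simp: bij_betw_def inj_on_def)
    \<comment> \<open>All vertices of \<open>W\<close> are below \<open>k\<close>, so the three
      numbers starting at \<open>k\<close> are fresh.\<close>
    let ?f = "f(x := k, a := k + 1, b := k + 2)"
    let ?F = "\<lambda>p q. F p q \<or> adj_of {(f v, k), (k, k + 1), (k, k + 2)} p q"
    have kW: "k \<notin> W" "k + 1 \<notin> W" "k + 2 \<notin> W" using k[of k] k[of "k + 1"] k[of "k + 2"] by auto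
    have "appended3 (W \<union> {k, k + 1, k + 2}) ?F"
      using appended3.step[OF W(1) fW[OF vV], of k "k + 1" "k + 2"] kW by auto
    moreover have "bij_betw ?f (V \<union> {x, a, b}) (W \<union> {k, k + 1, k + 2})"
    proof (rule bij_betw_combine)
      have "bij_betw ?f V W \<longleftrightarrow> bij_betw f V W" using pe(15-17) by (intro bij_betw_cong) auto
      then show "bij_betw ?f V W" using W(2) by blast
      show "bij_betw ?f {x, a, b} {k, k + 1, k + 2}" using pe(1-6) by (auto simp: bij_betw_def inj_on_def)
    qed (use kW in auto)
    moreover have "E s t \<longleftrightarrow> ?F (?f s) (?f t)" if st: "s \<in> V \<union> {x, a, b}" "t \<in> V \<union> {x, a, b}" for s t
    proof -
      have old: "?f u = f u" "f u \<noteq> k" "f u \<noteq> k + 1" "f u \<noteq> k + 2" "k \<noteq> f u" "Suc k \<noteq> f u" "Suc (Suc k) \<noteq> f u" if "u \<in> V" for u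
        using that pe(15-17) fW[OF that] kW by auto
      have nF: "\<not> F k q" "\<not> F (Suc k) q" "\<not> F (Suc (Suc k)) q" "\<not> F q k" "\<not> F q (Suc k)" "\<not> F q (Suc (Suc k))" for q
        using FW kW by auto
      have new: "?f x = k" "?f a = k + 1" "?f b = k + 2" using pe(1-6) by auto
      consider "s \<in> V" "t \<in> V" | "s \<in> V" "t \<in> {x, a, b}" | "s \<in> {x, a, b}" "t \<in> V" | "s \<in> {x, a, b}" "t \<in> {x, a, b}"
        using st by blast
      then show ?thesis
      proof cases
        case 1
        then show ?thesis using W(3) old by (auto simp: adj_of_def)
      next
        case 2
        then show ?thesis using old(1)[of s] old(2-7)[of s] fv[of s] pe nF new vV by (auto simp: adj_of_def)
      next
        case 3
        then show ?thesis using old(1)[of t] old(2-7)[of t] fv[of t] pe nF new vV by (auto simp: adj_of_def)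
      next
        case 4
        then show ?thesis using old[OF vV] pe(1-12) nF new E_irrefl by (auto simp: adj_of_def)
      qed
    qed
    ultimately show ?case by blast
  qed
  then show ?thesis unfolding graph_iso_def by blast
qed

end

text \<open>The bounds are put on a surrounding graph \<open>W\<close> because all stages of the
  construction are induced subgraphs of the final tree and inherit its degree bound and its lack of
  long paths.\<close>

lemma appended3_claw_tree:
  assumes "sgraph E" "appended3 V G" "\<And>x y. x \<in> V \<Longrightarrow> y \<in> V \<Longrightarrow> G x y \<longleftrightarrow> E x y" "V \<subseteq> W" "finite W"
    and deg: "\<And>u. u \<in> W \<Longrightarrow> card (sgraph.nbrs E W u) \<le> 3"
    and short: "\<And>p. walk W E p \<Longrightarrow> distinct p \<Longrightarrow> length p \<le> 7"
  shows "\<exists>c l m n. sgraph.claw_tree E V c l m n"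
proof -
  interpret sgraph E by fact
  show ?thesis using assms(2-4)
  proof (induction rule: appended3.induct)
    case (base c a b d)
    have "claw c a b d"
      using base.hyps base.prems(1)[of c a] base.prems(1)[of c b] base.prems(1)[of c d]
        base.prems(1)[of a b] base.prems(1)[of a d] base.prems(1)[of b d]
      unfolding claw_def by (auto simp: adj_of_def)
    then have "claw_tree {c, a, b, d} c a b d" by (simp add: claw_tree_def hung.core)
    then show ?case by blast
  next
    case (step V G v c a b)
    let ?V = "V \<union> {c, a, b}"
    let ?G = "\<lambda>x y. G x y \<or> adj_of {(v, c), (c, a), (c, b)} x y"
    have GV: "x \<in> V \<and> y \<in> V" if "G x y" for x y using appended3_graph[OF step.hyps(1)] that by blast
    have old: "G x y \<longleftrightarrow> E x y" if "x \<in> V" "y \<in> V" for x y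
      using step.prems(1)[of x y] that step.hyps by (auto simp: adj_of_def)
    have new: "E x y \<longleftrightarrow> adj_of {(v, c), (c, a), (c, b)} x y" if "x \<in> ?V" "y \<in> ?V" "x \<notin> V" for x y
      using step.prems(1)[of x y] that GV by blast
    have p: "pendant3 V v c a b"
      unfolding pendant3_def using step.hyps new[of c] new[of a] new[of b] by (auto simp: adj_of_def)
    have fin: "finite V" using step.prems(2) assms(5) finite_subset by blast
    have degV: "\<forall>u\<in>?V. card (nbrs ?V u) \<le> 3"
    proof
      fix u assume u: "u \<in> ?V"
      have "card (nbrs ?V u) \<le> card (nbrs W u)"
        using step.prems(2) assms(5) by (intro card_mono) (auto simp: nbrs_def)
      then show "card (nbrs ?V u) \<le> 3" using deg[of u] u step.prems(2) by auto
    qed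
    obtain c' l m n where cl: "claw_tree V c' l m n" using step.IH[OF old] step.prems(2) by blast
    from cl fin p degV show ?case
    proof (cases rule: claw_tree_attach)
      case claw_tree
      then show ?thesis by blast
    next
      case (far X t r s y f g u e)
      have h: "claw c' t r s" "{c', t, r, s} \<subseteq> X" using far(2) hung_subset by (auto simp: claw_tree_def)
      note ce = claw_edges[OF h(1)] and p1 = pendant3_edges[OF far(3)] and p2 = pendant3_edges[OF far(4)]
        and p3 = pendant3_edges[OF p]
      \<comment> \<open>A path from a new leaf over the star at \<open>t\<close> and the root to a
        leaf of the star at \<open>s\<close>: nine vertices, two more than diameter 6
        admits.\<close>
      let ?p = "[a, c, v, u, t, c', s, y, f]"
      have mem: "{v, u, t, c', s, y, f} \<subseteq> V" using far(1) h(2) by auto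
      have "set ?p \<subseteq> ?V" using mem by auto
      then have sub: "set ?p \<subseteq> W" using step.prems(2) by blast
      have mX: "c' \<in> X" "t \<in> X" "s \<in> X" using h(2) by auto
      have "distinct [c', t, s]" using ce by simp
      moreover have "y \<notin> {c', t, s}" "f \<notin> {c', t, s}" using p1(15,16) mX by blast+
      moreover have "u \<notin> {c', t, s, y, f}" "v \<notin> {c', t, s, y, f}" using p2(15,16) mX by blast+
      moreover have "c \<notin> {v, u, t, c', s, y, f}" "a \<notin> {v, u, t, c', s, y, f}" using p3(15,16) mem by blast+
      ultimately have d: "distinct ?p" using p1(1) p2(1) p3(1) by auto
      have "E a c" "E c v" "E v u" "E u t" "E t c'" "E c' s" "E s y" "E y f"
        using p1(7,14) p2(9,13) p3(9,13) ce(15,16) by simp_all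
      then have "walk W E ?p" using sub by (simp add: walk_Cons walk_single)
      then show ?thesis using short[OF _ d] by simp
    qed
  qed
qed

lemma appended3_code_bound:
  assumes "appended3 W F" "max_degree W F = 3" "diam_le W F 6" "\<not> has_cycle W F" "identifying_code W F C"
  shows "3 * card (W - C) + 1 \<le> card W"
proof -
  interpret sgraph F using appended3_sgraph assms(1) .
  have fin: "finite W" using appended3_graph[OF assms(1)] by blast
  have deg: "card (nbrs W u) \<le> 3" if "u \<in> W" for u
    using that fin assms(2) Max_ge[of "degree W F ` W" "degree W F u"] by (simp add: max_degree_def degree_def nbrs_def)
  have "\<exists>c l m n. claw_tree W c l m n"
    by (rule appended3_claw_tree[OF sgraph_axioms assms(1) refl subset_refl fin deg])
      (use diam_distinct_walk[OF assms(4,3)] in auto)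
  then show ?thesis using claw_tree_code_bound assms(5) identifying_code_iff by blast
qed

lemma T2_code_bound:
  assumes "identifying_code T2_V T2_E C"
  shows "3 * card (T2_V - C) + 1 \<le> card T2_V"
proof -
  interpret sgraph T2_E by unfold_locales (auto simp: T2_E_def adj_of_def)
  have "pendant3 {0, 1, 2, 3} 3 4 5 6" unfolding pendant3_def by (simp add: T2_E_def adj_of_def)
  then have "hung {0, 1, 2, 3} {3} ({0, 1, 2, 3} \<union> {4, 5, 6})" by (intro hung.hang hung.core) auto
  moreover have "{0, 1, 2, 3} \<union> {4, 5, 6} = T2_V" by (auto simp: T2_V_def)
  ultimately have "path_tree T2_V 0 1 2 3" unfolding path_tree_def path4_def by (simp add: T2_E_def adj_of_def)
  then show ?thesis using path_tree_code_bound assms identifying_code_iff by blast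
qed

lemma T3_code_bound:
  assumes "identifying_code T3_V T3_E C"
  shows "3 * card (T3_V - C) + 1 \<le> card T3_V"
proof -
  interpret sgraph T3_E by unfold_locales (auto simp: T3_E_def adj_of_def)
  have "pendant3 {0, 1, 2, 3} 3 4 5 6" "pendant3 ({0, 1, 2, 3} \<union> {4, 5, 6}) 3 7 8 9"
    unfolding pendant3_def by (simp_all add: T3_E_def adj_of_def)
  then have "hung {0, 1, 2, 3} {3} ({0, 1, 2, 3} \<union> {4, 5, 6} \<union> {7, 8, 9})" by (intro hung.hang hung.core) auto
  moreover have "{0, 1, 2, 3} \<union> {4, 5, 6} \<union> {7, 8, 9} = T3_V" by (auto simp: T3_V_def)
  ultimately have "path_tree T3_V 0 1 2 3" unfolding path_tree_def path4_def by (simp add: T3_E_def adj_of_def)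
  then show ?thesis using path_tree_code_bound assms identifying_code_iff by blast
qed

lemma star_code_bound:
  assumes "identifying_code (star_V \<Delta>) (star_E \<Delta>) C"
  shows "\<Delta> * card (star_V \<Delta> - C) + 1 \<le> card (star_V \<Delta>)"
proof -
  interpret sgraph "star_E \<Delta>" by unfold_locales (auto simp: star_E_def adj_of_def)
  have N: "nbrs (star_V \<Delta>) 0 = {1..\<Delta>}" "\<And>u. u \<in> {1..\<Delta>} \<Longrightarrow> nbrs (star_V \<Delta>) u = {0}"
    unfolding nbrs_def by (auto simp: star_V_def star_E_def adj_of_def)
  have "star_V \<Delta> = insert 0 {1..\<Delta>}" by (auto simp: star_V_def)
  then have "big_star \<Delta> (star_V \<Delta>)" unfolding big_star_def using N by (intro bexI[of _ 0]) auto
  moreover have "finite (star_V \<Delta>)" by (simp add: star_V_def)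
  moreover have "almost_code (star_V \<Delta>) {} C" using assms identifying_code_iff by blast
  ultimately show ?thesis by (rule big_star_code_bound)
qed

text \<open>The acyclicity that turns \<open>diam_le\<close> into a bound on paths is carried over
  from the given tree by the isomorphism.\<close>

lemma family_code_bound:
  assumes "in_T_family \<Delta> W F" "graph_iso V E W F" "tree V E" "identifying_code V E C"
  shows "\<Delta> * card (V - C) + 1 \<le> card V"
proof (rule iso_code_bound[OF assms(2) _ assms(4)])
  have "\<not> has_cycle V E" using assms(3) by (simp add: tree_def)
  then have "\<not> has_cycle W F" using iso_has_cycle[OF graph_iso_sym[OF assms(2)]] by blast
  then show "\<Delta> * card (W - C) + 1 \<le> card W" if "identifying_code W F C" for C
    using that assms(1) T2_code_bound T3_code_bound star_code_bound appended3_code_bound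
    unfolding in_T_family_def by (metis (full_types))
qed

section \<open>Exceptional trees of maximum degree \<Delta> belong to the family\<close>

context sgraph begin

text \<open>The bare path has maximum degree 2, and three stars together with \<open>y\<close> would
  give \<open>z\<close> degree at least 4; so exactly one or two stars hang at
  \<open>z\<close>.\<close>

lemma path_tree_iso:
  assumes "path_tree V w x y z" "max_degree V E = 3"
  shows "graph_iso V E T2_V T2_E \<or> graph_iso V E T3_V T3_E"
proof -
  let ?K = "{w, x, y, z}"
  have h: "path4 w x y z" "hung ?K {z} V" using assms(1) by (auto simp: path_tree_def)
  note pe = path4_edges[OF h(1)]
  have fin: "finite V" using hung_finite[OF h(2)] by simp
  have KV: "?K \<subseteq> V" using hung_subset[OF h(2)] .
  have deg: "card (nbrs V u) \<le> 3" if "u \<in> V" for u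
    using that fin assms(2) Max_ge[of "degree V E ` V" "degree V E u"] by (simp add: max_degree_def degree_def nbrs_def)
  have nK: "V \<noteq> ?K"
  proof
    assume V: "V = ?K"
    have "max_degree V E \<in> degree V E ` V" unfolding max_degree_def using fin KV by (intro Max_in) auto
    then obtain u where u: "u \<in> ?K" "card (nbrs ?K u) = 3" using assms(2) V by (auto simp: degree_def nbrs_def)
    have "nbrs ?K w = {x}" "nbrs ?K x = {w, y}" "nbrs ?K y = {x, z}" "nbrs ?K z = {y}"
      using pe E_irrefl by (auto simp: nbrs_def)
    then show False using u pe by auto
  qed
  obtain V1 u a b where 1: "V = V1 \<union> {u, a, b}" "hung ?K {z} V1" "pendant3 V1 z u a b"
    using h(2) nK by (cases rule: hung.cases) auto
  show ?thesis
  proof (cases "V1 = ?K")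
    case True
    let ?xs = "[w, x, y, z, u, a, b]"
    note q = pendant3_edges[OF 1(3)[unfolded True]]
    have seven: "T2_V = {0, 1, 2, 3, 4, 5, 6}" by (auto simp: T2_V_def)
    have "graph_iso V E T2_V T2_E"
    proof (rule graph_iso_inverse)
      show "bij_betw ((!) ?xs) T2_V V"
      proof (rule bij_betw_nth)
        show "distinct ?xs" using pe q by simp
        show "T2_V = {..<length ?xs}" by (auto simp: T2_V_def)
        show "V = set ?xs" using 1(1) True by auto
      qed
      have "\<forall>i\<in>T2_V. \<forall>j\<in>T2_V. T2_E i j \<longleftrightarrow> E (?xs ! i) (?xs ! j)"
        unfolding seven T2_E_def adj_of_def using pe q E_irrefl by simp
      then show "T2_E i j \<longleftrightarrow> E (?xs ! i) (?xs ! j)" if "i \<in> T2_V" "j \<in> T2_V" for i j using that by blast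
    qed
    then show ?thesis ..
  next
    case False
    obtain V2 u' a' b' where 2: "V1 = V2 \<union> {u', a', b'}" "hung ?K {z} V2" "pendant3 V2 z u' a' b'"
      using 1(2) False by (cases rule: hung.cases) auto
    have K2: "?K \<subseteq> V2" using hung_subset[OF 2(2)] .
    show ?thesis
    proof (cases "V2 = ?K")
      case True
      let ?xs = "[w, x, y, z, u', a', b', u, a, b]"
      note q = pendant3_edges[OF 2(3)[unfolded True]] and r = pendant3_edges[OF 1(3)[unfolded 2(1) True]]
      have ten: "T3_V = {0, 1, 2, 3, 4, 5, 6, 7, 8, 9}" by (auto simp: T3_V_def)
      have "graph_iso V E T3_V T3_E"
      proof (rule graph_iso_inverse)
        show "bij_betw ((!) ?xs) T3_V V"
        proof (rule bij_betw_nth)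
          show "distinct ?xs" using pe q r by simp
          show "T3_V = {..<length ?xs}" by (auto simp: T3_V_def)
          show "V = set ?xs" using 1(1) 2(1) True by auto
        qed
        have "\<forall>i\<in>T3_V. \<forall>j\<in>T3_V. T3_E i j \<longleftrightarrow> E (?xs ! i) (?xs ! j)"
          unfolding ten T3_E_def adj_of_def using pe q r E_irrefl by simp
        then show "T3_E i j \<longleftrightarrow> E (?xs ! i) (?xs ! j)" if "i \<in> T3_V" "j \<in> T3_V" for i j using that by blast
      qed
      then show ?thesis ..
    next
      case False
      obtain V3 u'' a'' b'' where 3: "V2 = V3 \<union> {u'', a'', b''}" "hung ?K {z} V3" "pendant3 V3 z u'' a'' b''"
        using 2(2) False by (cases rule: hung.cases) auto
      have "y \<in> V3" using hung_subset[OF 3(2)] by blast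
      moreover have "u'' \<notin> V3" "u' \<notin> V2" "u \<notin> V1"
        using 1(3) 2(3) 3(3) by (simp_all add: pendant3_def)
      moreover note pendant3_edges(14)[OF 1(3)] pendant3_edges(14)[OF 2(3)] pendant3_edges(14)[OF 3(3)]
      ultimately have "\<not> card (nbrs V z) \<le> 3"
        using 1(1) 2(1) 3(1) pe(18) fin by (intro degree_4[of V y u u' u'']) auto
      then show ?thesis using deg KV by blast
    qed
  qed
qed

lemma big_star_iso:
  assumes "big_star \<Delta> V" "finite V"
  shows "graph_iso V E (star_V \<Delta>) (star_E \<Delta>)"
proof -
  obtain c where c: "c \<in> V" "V = insert c (nbrs V c)" "card (nbrs V c) = \<Delta>" "\<And>u. u \<in> nbrs V c \<Longrightarrow> nbrs V u = {c}"
    using assms(1) unfolding big_star_def by blast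
  have fin: "finite (nbrs V c)" and cN: "c \<notin> nbrs V c" using assms(2) E_irrefl by (auto simp: nbrs_def)
  obtain L where L: "set L = nbrs V c" "distinct L" using finite_distinct_list[OF fin] by blast
  then have len: "length L = \<Delta>" using c(3) distinct_card by fastforce
  have LV: "L ! i \<in> nbrs V c" if "i < \<Delta>" for i using that len L(1) nth_mem by blast
  have cL: "E c (L ! i)" "E (L ! i) c" if "i < \<Delta>" for i using LV[OF that] E_sym by (auto simp: nbrs_def)
  have LL: "\<not> E (L ! i) (L ! j)" if "i < \<Delta>" "j < \<Delta>" for i j
  proof
    assume "E (L ! i) (L ! j)"
    then have "L ! j \<in> nbrs V (L ! i)" using LV[OF that(2)] by (simp add: nbrs_def)
    then have "L ! j = c" using c(4)[OF LV[OF that(1)]] by blast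
    then show False using LV[OF that(2)] cN by simp
  qed
  show ?thesis
  proof (rule graph_iso_inverse)
    have "set (c # L) = V" using L(1) c(2) by simp
    then show "bij_betw ((!) (c # L)) (star_V \<Delta>) V"
      using L cN len by (intro bij_betw_nth) (auto simp: star_V_def)
    show "star_E \<Delta> i j \<longleftrightarrow> E ((c # L) ! i) ((c # L) ! j)" if "i \<in> star_V \<Delta>" "j \<in> star_V \<Delta>" for i j
      using that cL LL E_irrefl by (cases i; cases j) (auto simp: star_E_def star_V_def adj_of_def)
  qed
qed

lemma exceptional_in_family:
  assumes ex: "exceptional \<Delta> V" and \<Delta>: "\<Delta> = max_degree V E" "3 \<le> \<Delta>" and fin: "finite V"
  shows "\<exists>W F. in_T_family \<Delta> W F \<and> graph_iso V E W F"
proof -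
  have nsing: "V \<noteq> {v}" for v
  proof
    assume "V = {v}"
    then have "max_degree V E = 0" using E_irrefl by (simp add: max_degree_def degree_def)
    then show False using \<Delta> by simp
  qed
  consider (path) w x y z where "\<Delta> = 3" "path_tree V w x y z" | (claw) c l m n where "\<Delta> = 3" "claw_tree V c l m n"
    | (star) "4 \<le> \<Delta>" "big_star \<Delta> V"
    using ex nsing unfolding exceptional_def exceptional3_def by blast
  then show ?thesis
  proof cases
    case path
    then have "graph_iso V E T2_V T2_E \<or> graph_iso V E T3_V T3_E" using path_tree_iso \<Delta>(1) by simp
    then show ?thesis using path(1) unfolding in_T_family_def by auto
  next
    case claw
    obtain W F where W: "appended3 W F" "graph_iso V E W F" using claw_tree_appended claw(2) by blast
    then have "max_degree W F = 3" "diam_le W F 6"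
      using iso_max_degree iso_diam_le claw_tree_diam[OF claw(2)] claw(1) \<Delta>(1) by metis+
    then show ?thesis using W claw(1) unfolding in_T_family_def by auto
  next
    case star
    then show ?thesis using big_star_iso fin unfolding in_T_family_def by auto
  qed
qed

end

theorem mainTheorem1:
  fixes V :: "'a set" and E :: "'a \<Rightarrow> 'a \<Rightarrow> bool" and n \<Delta> :: nat
  assumes "tree V E" and "n = card V" and "\<Delta> = max_degree V E" and "\<Delta> \<ge> 3"
  shows "((\<exists>W F. in_T_family \<Delta> W F \<and> graph_iso V E W F) \<longrightarrow>
            real (gamma_ID V E) = ((real \<Delta> - 1) / real \<Delta>) * real n + 1 / real \<Delta>)
       \<and> ((\<not> (\<exists>W F. in_T_family \<Delta> W F \<and> graph_iso V E W F)) \<longrightarrow>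
            real (gamma_ID V E) \<le> ((real \<Delta> - 1) / real \<Delta>) * real n)"
proof -
  interpret sgraph E using assms(1) by unfold_locales (auto simp: tree_def graph_def)
  have st: "subtree V" using tree_imp_subtree assms(1) .
  have fin: "finite V" "V \<noteq> {}" using st by (auto simp: subtree_def)
  have deg: "card (nbrs V u) \<le> \<Delta>" if "u \<in> V" for u
    using that fin assms(3) Max_ge[of "degree V E ` V" "degree V E u"] by (simp add: max_degree_def degree_def nbrs_def)
  have n2: "card V \<noteq> 2"
  proof
    assume c2: "card V = 2"
    have "\<Delta> \<in> degree V E ` V" unfolding assms(3) max_degree_def using fin by (intro Max_in) auto
    then obtain u where "\<Delta> = card (nbrs V u)" by (auto simp: degree_def nbrs_def)
    moreover have "card (nbrs V u) \<le> card V" using fin by (intro card_mono) (auto simp: nbrs_def)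
    ultimately show False using assms(4) c2 by simp
  qed
  have settled: "bounded_code \<Delta> V 0 \<or> exceptional \<Delta> V \<and> bounded_code \<Delta> V 1"
    using tree_settled[OF st deg assms(4)] n2 unfolding settled_def by blast
  let ?S = "{card C | C. identifying_code V E C}"
  have finS: "finite ?S"
  proof -
    have "?S \<subseteq> card ` Pow V" by (auto simp: identifying_code_def)
    then show ?thesis using fin finite_subset by blast
  qed
  have upper: "\<Delta> * gamma_ID V E + n \<le> \<Delta> * n + e" if b: "bounded_code \<Delta> V e" for e
  proof -
    obtain C where C: "identifying_code V E C" "\<Delta> * card C + card V \<le> \<Delta> * card V + e"
      using b unfolding bounded_code_def identifying_code_iff by blast
    then have "gamma_ID V E \<le> card C" unfolding gamma_ID_def by (intro Min_le[OF finS]) blast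
    then have "\<Delta> * gamma_ID V E \<le> \<Delta> * card C" by simp
    then show ?thesis using C(2) unfolding assms(2) by linarith
  qed
  have pos: "real \<Delta> > 0" using assms(4) by simp
  show ?thesis
  proof (intro conjI impI)
    assume "\<exists>W F. in_T_family \<Delta> W F \<and> graph_iso V E W F"
    then obtain W F where WF: "in_T_family \<Delta> W F" "graph_iso V E W F" by blast
    \<comment> \<open>The upper bound also supplies the existence of a code, without which the
      minimum in \<open>gamma_ID\<close> would not be attained.\<close>
    have b1: "bounded_code \<Delta> V 1" using settled bounded_code_mono[of \<Delta> V 0 1] by auto
    then have "?S \<noteq> {}" unfolding bounded_code_def identifying_code_iff[symmetric] by blast
    then have "gamma_ID V E \<in> ?S" unfolding gamma_ID_def using Min_in[OF finS] by blast
    then obtain C where C: "identifying_code V E C" "gamma_ID V E = card C" by blast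
    then have CV: "C \<subseteq> V" by (simp add: identifying_code_def)
    \<comment> \<open>Bounding the omitted vertices of an optimal code from above is the same as
      bounding its size from below.\<close>
    have "\<Delta> * card (V - C) + 1 \<le> n" using family_code_bound[OF WF assms(1) C(1)] assms(2) by simp
    moreover have "card (V - C) + card C = n"
      using CV fin assms(2) by (simp add: card_Diff_subset finite_subset card_mono)
    then have "\<Delta> * card (V - C) + \<Delta> * card C = \<Delta> * n" by (metis distrib_left)
    ultimately have "\<Delta> * n + 1 \<le> \<Delta> * gamma_ID V E + n" using C(2) by simp
    then have "\<Delta> * gamma_ID V E + n = \<Delta> * n + 1" using upper[OF b1] by simp
    then have "real \<Delta> * real (gamma_ID V E) + real n = real \<Delta> * real n + 1"
      by (metis of_nat_1 of_nat_add of_nat_mult)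
    then show "real (gamma_ID V E) = (real \<Delta> - 1) / real \<Delta> * real n + 1 / real \<Delta>"
      using pos by (simp add: field_simps)
  next
    assume "\<not> (\<exists>W F. in_T_family \<Delta> W F \<and> graph_iso V E W F)"
    then have "bounded_code \<Delta> V 0" using settled exceptional_in_family assms(3,4) fin by blast
    then have "\<Delta> * gamma_ID V E + n \<le> \<Delta> * n" using upper[of 0] by simp
    then have "real \<Delta> * real (gamma_ID V E) + real n \<le> real \<Delta> * real n"
      by (metis of_nat_add of_nat_le_iff of_nat_mult)
    then show "real (gamma_ID V E) \<le> (real \<Delta> - 1) / real \<Delta> * real n"
      using pos by (simp add: field_simps)
  qed
qed

end
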